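(* Let $M$ be a $2m$-dimensional almost Hermitian manifold with indefinite metric $g$ of signature $(2s,2(m-s))$, $0<s<m$, where $m>1$. Suppose that for each point $p\in M$ there exists a constant $c(p)$ such that for every vector $x\in T_pM$ with $g(x,x)=1$ the holomorphic sectional curvature satisfies $$|H(x)|\le c(p).$$ Then $M$ is of pointwise constant holomorphic sectional curvature.
   Context: An almost Hermitian manifold is a smooth manifold $M$ with a (here pseudo-Riemannian) metric tensor $g$ and an almost complex structure $J$ satisfying $J^2=-\mathrm{id}$ and $g(X,Y)=g(JX,JY)$. Signature $(2s,2(m-s))$ means that each tangent space is isometric to $\mathbb{R}^{2m}$ with the inner product $-\sum_{i=1}^{2s}X^iY^i+\sum_{j=2s+1}^{2m}X^jY^j$. Let $\nabla$ be the Levi-Civita connection, $R(X,Y)=[\nabla_X,\nabla_Y]-\nabla_{[X,Y]}$ the curvature tensor, and $R(X,Y,Z,U)=g(R(X,Y)Z,U)$. A unit vector is a tangent vector $X$ with $g(X,X)=\pm1$. For a unit vector $X$, the holomorphic sectional curvature is $H(X)=K(X,JX)=R(X,JX,JX,X)$. The manifold $M$ is of pointwise constant holomorphic sectional curvature if for every $p\in M$ there is a constant $k(p)$ such that $H(X)=k(p)$ for every unit vector $X\in T_pM$. *)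

theory Defs
  imports "HOL-Analysis.Analysis"
begin

section \<open>Smooth manifolds\<close>

text \<open>For open \<open>S\<close> in a finite-dimensional space, where a map is of class \<open>C\<^sup>k\<^sup>+\<^sup>1\<close> iff it is
  differentiable and all its directional derivatives are of class \<open>C\<^sup>k\<close>.\<close>

primrec C_k_on :: "nat \<Rightarrow> 'e::euclidean_space set \<Rightarrow> ('e \<Rightarrow> 'f::real_normed_vector) \<Rightarrow> bool" where
  "C_k_on 0 S f \<longleftrightarrow> continuous_on S f"
| "C_k_on (Suc k) S f \<longleftrightarrow>
     f differentiable_on S \<and> (\<forall>v. C_k_on k S (\<lambda>x. frechet_derivative f (at x) v))"

definition smooth_on :: "'e::euclidean_space set \<Rightarrow> ('e \<Rightarrow> 'f::real_normed_vector) \<Rightarrow> bool" where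
  "smooth_on S f \<longleftrightarrow> (\<forall>k. C_k_on k S f)"

text \<open>A chart is a pair of its domain and the coordinate map; the values of the coordinate map
  outside the domain are irrelevant. The manifold is the whole type \<open>'a\<close>. An atlas need not be
  maximal.\<close>

type_synonym ('a, 'e) chart = "'a set \<times> ('a \<Rightarrow> 'e)"

definition is_chart :: "('a::topological_space, 'e::euclidean_space) chart \<Rightarrow> bool" where
  "is_chart = (\<lambda>(U, \<phi>). open U \<and> open (\<phi> ` U) \<and> homeomorphism U (\<phi> ` U) \<phi> (inv_into U \<phi>))"

definition smooth_atlas ::
  "('a::{t2_space, second_countable_topology}, 'e::euclidean_space) chart set \<Rightarrow> bool" where
  "smooth_atlas A \<longleftrightarrow>
     (\<forall>c\<in>A. is_chart c) \<and> (\<Union>(U, \<phi>)\<in>A. U) = UNIV \<and>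
     (\<forall>(U, \<phi>)\<in>A. \<forall>(V, \<psi>)\<in>A. smooth_on (\<phi> ` (U \<inter> V)) (\<psi> \<circ> inv_into U \<phi>))"

definition smooth_functions :: "('a, 'e::euclidean_space) chart set \<Rightarrow> ('a \<Rightarrow> real) set" where
  "smooth_functions A = {f. \<forall>(U, \<phi>)\<in>A. smooth_on (\<phi> ` U) (f \<circ> inv_into U \<phi>)}"


section \<open>Tangent vectors and vector fields\<close>

text \<open>Tangent vectors at \<open>p\<close> are the derivations at \<open>p\<close> of the algebra of smooth functions. They are
  taken to vanish on functions that are not smooth, so that derivations which agree on smooth
  functions are equal.\<close>

type_synonym 'a tvec = "('a \<Rightarrow> real) \<Rightarrow> real"

definition tadd :: "'a tvec \<Rightarrow> 'a tvec \<Rightarrow> 'a tvec" where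
  "tadd x y = (\<lambda>f. x f + y f)"

definition tscale :: "real \<Rightarrow> 'a tvec \<Rightarrow> 'a tvec" where
  "tscale a x = (\<lambda>f. a * x f)"

definition tangent_space :: "('a, 'e::euclidean_space) chart set \<Rightarrow> 'a \<Rightarrow> 'a tvec set" where
  "tangent_space A p = {x.
     (\<forall>f. f \<notin> smooth_functions A \<longrightarrow> x f = 0) \<and>
     (\<forall>f\<in>smooth_functions A. \<forall>a. x (\<lambda>q. a * f q) = a * x f) \<and>
     (\<forall>f\<in>smooth_functions A. \<forall>h\<in>smooth_functions A. x (\<lambda>q. f q + h q) = x f + x h) \<and>
     (\<forall>f\<in>smooth_functions A. \<forall>h\<in>smooth_functions A.
        x (\<lambda>q. f q * h q) = x f * h p + f p * x h)}"

type_synonym 'a vfield = "'a \<Rightarrow> 'a tvec"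

definition vector_fields :: "('a, 'e::euclidean_space) chart set \<Rightarrow> 'a vfield set" where
  "vector_fields A = {X. (\<forall>p. X p \<in> tangent_space A p) \<and>
     (\<forall>f\<in>smooth_functions A. (\<lambda>p. X p f) \<in> smooth_functions A)}"

definition vadd :: "'a vfield \<Rightarrow> 'a vfield \<Rightarrow> 'a vfield" where
  "vadd X Y = (\<lambda>p. tadd (X p) (Y p))"

definition vdiff :: "'a vfield \<Rightarrow> 'a vfield \<Rightarrow> 'a vfield" where
  "vdiff X Y = (\<lambda>p. tadd (X p) (tscale (-1) (Y p)))"

definition vscale :: "('a \<Rightarrow> real) \<Rightarrow> 'a vfield \<Rightarrow> 'a vfield" where
  "vscale f X = (\<lambda>p. tscale (f p) (X p))"

definition lie_bracket :: "'a vfield \<Rightarrow> 'a vfield \<Rightarrow> 'a vfield" where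
  "lie_bracket X Y = (\<lambda>p f. X p (\<lambda>q. Y q f) - Y p (\<lambda>q. X q f))"


section \<open>Pseudo-Riemannian metrics and almost Hermitian structures\<close>

type_synonym 'a metric_tensor = "'a \<Rightarrow> 'a tvec \<Rightarrow> 'a tvec \<Rightarrow> real"

definition pseudo_riemannian_metric ::
  "('a, 'e::euclidean_space) chart set \<Rightarrow> 'a metric_tensor \<Rightarrow> bool" where
  "pseudo_riemannian_metric A g \<longleftrightarrow>
     (\<forall>p. \<forall>x\<in>tangent_space A p. \<forall>y\<in>tangent_space A p. g p x y = g p y x) \<and>
     (\<forall>p. \<forall>x\<in>tangent_space A p. \<forall>y\<in>tangent_space A p. \<forall>z\<in>tangent_space A p.
        g p (tadd x y) z = g p x z + g p y z) \<and>
     (\<forall>p. \<forall>x\<in>tangent_space A p. \<forall>y\<in>tangent_space A p. \<forall>a. g p (tscale a x) y = a * g p x y) \<and>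
     (\<forall>p. \<forall>x\<in>tangent_space A p. (\<forall>y\<in>tangent_space A p. g p x y = 0) \<longrightarrow> x = (\<lambda>f. 0)) \<and>
     (\<forall>X\<in>vector_fields A. \<forall>Y\<in>vector_fields A. (\<lambda>p. g p (X p) (Y p)) \<in> smooth_functions A)"

text \<open>\<open>\<real>\<^sup>n\<close> is represented by the functions on \<open>nat\<close> supported in \<open>{1..n}\<close>.\<close>

definition coord_space :: "nat \<Rightarrow> (nat \<Rightarrow> real) set" where
  "coord_space n = {u. \<forall>i. i \<notin> {1..n} \<longrightarrow> u i = 0}"

definition pseudo_inner :: "nat \<Rightarrow> nat \<Rightarrow> (nat \<Rightarrow> real) \<Rightarrow> (nat \<Rightarrow> real) \<Rightarrow> real" where
  "pseudo_inner k n u v = - (\<Sum>i\<in>{1..k}. u i * v i) + (\<Sum>j\<in>{k+1..n}. u j * v j)"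

text \<open>\<open>has_signature A g k l\<close>: \<open>k\<close> minus signs and \<open>l\<close> plus signs.\<close>

definition has_signature ::
  "('a, 'e::euclidean_space) chart set \<Rightarrow> 'a metric_tensor \<Rightarrow> nat \<Rightarrow> nat \<Rightarrow> bool" where
  "has_signature A g k l \<longleftrightarrow> (\<forall>p. \<exists>L.
     bij_betw L (coord_space (k + l)) (tangent_space A p) \<and>
     (\<forall>u\<in>coord_space (k + l). \<forall>v\<in>coord_space (k + l). L (\<lambda>i. u i + v i) = tadd (L u) (L v)) \<and>
     (\<forall>u\<in>coord_space (k + l). \<forall>a. L (\<lambda>i. a * u i) = tscale a (L u)) \<and>
     (\<forall>u\<in>coord_space (k + l). \<forall>v\<in>coord_space (k + l).
        g p (L u) (L v) = pseudo_inner k (k + l) u v))"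

type_synonym 'a endo_field = "'a \<Rightarrow> 'a tvec \<Rightarrow> 'a tvec"

definition almost_complex_structure ::
  "('a, 'e::euclidean_space) chart set \<Rightarrow> 'a endo_field \<Rightarrow> bool" where
  "almost_complex_structure A J \<longleftrightarrow>
     (\<forall>p. \<forall>x\<in>tangent_space A p. J p x \<in> tangent_space A p) \<and>
     (\<forall>p. \<forall>x\<in>tangent_space A p. \<forall>y\<in>tangent_space A p.
        J p (tadd x y) = tadd (J p x) (J p y)) \<and>
     (\<forall>p. \<forall>x\<in>tangent_space A p. \<forall>a. J p (tscale a x) = tscale a (J p x)) \<and>
     (\<forall>p. \<forall>x\<in>tangent_space A p. J p (J p x) = tscale (-1) x) \<and>
     (\<forall>X\<in>vector_fields A. (\<lambda>p. J p (X p)) \<in> vector_fields A)"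

definition almost_hermitian_manifold ::
  "('a::{t2_space, second_countable_topology}, 'e::euclidean_space) chart set \<Rightarrow>
   'a metric_tensor \<Rightarrow> 'a endo_field \<Rightarrow> bool" where
  "almost_hermitian_manifold A g J \<longleftrightarrow>
     smooth_atlas A \<and> pseudo_riemannian_metric A g \<and> almost_complex_structure A J \<and>
     (\<forall>p. \<forall>x\<in>tangent_space A p. \<forall>y\<in>tangent_space A p. g p (J p x) (J p y) = g p x y)"


section \<open>Levi-Civita connection and curvature\<close>

type_synonym 'a connection = "'a vfield \<Rightarrow> 'a vfield \<Rightarrow> 'a vfield"

definition affine_connection ::
  "('a, 'e::euclidean_space) chart set \<Rightarrow> 'a connection \<Rightarrow> bool" where
  "affine_connection A D \<longleftrightarrow>
     (\<forall>X\<in>vector_fields A. \<forall>Y\<in>vector_fields A. D X Y \<in> vector_fields A) \<and>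
     (\<forall>X\<in>vector_fields A. \<forall>Y\<in>vector_fields A. \<forall>Z\<in>vector_fields A.
        D (vadd X Y) Z = vadd (D X Z) (D Y Z)) \<and>
     (\<forall>f\<in>smooth_functions A. \<forall>X\<in>vector_fields A. \<forall>Y\<in>vector_fields A.
        D (vscale f X) Y = vscale f (D X Y)) \<and>
     (\<forall>X\<in>vector_fields A. \<forall>Y\<in>vector_fields A. \<forall>Z\<in>vector_fields A.
        D X (vadd Y Z) = vadd (D X Y) (D X Z)) \<and>
     (\<forall>f\<in>smooth_functions A. \<forall>X\<in>vector_fields A. \<forall>Y\<in>vector_fields A.
        D X (vscale f Y) = vadd (vscale (\<lambda>p. X p f) Y) (vscale f (D X Y)))"

definition levi_civita_connection ::
  "('a, 'e::euclidean_space) chart set \<Rightarrow> 'a metric_tensor \<Rightarrow> 'a connection \<Rightarrow> bool" where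
  "levi_civita_connection A g D \<longleftrightarrow>
     affine_connection A D \<and>
     (\<forall>X\<in>vector_fields A. \<forall>Y\<in>vector_fields A. vdiff (D X Y) (D Y X) = lie_bracket X Y) \<and>
     (\<forall>X\<in>vector_fields A. \<forall>Y\<in>vector_fields A. \<forall>Z\<in>vector_fields A. \<forall>p.
        X p (\<lambda>q. g q (Y q) (Z q)) = g p (D X Y p) (Z p) + g p (Y p) (D X Z p))"

definition curvature :: "'a connection \<Rightarrow> 'a vfield \<Rightarrow> 'a vfield \<Rightarrow> 'a vfield \<Rightarrow> 'a vfield" where
  "curvature D X Y Z =
     vdiff (vdiff (D X (D Y Z)) (D Y (D X Z))) (D (lie_bracket X Y) Z)"

definition field_through :: "('a, 'e::euclidean_space) chart set \<Rightarrow> 'a \<Rightarrow> 'a tvec \<Rightarrow> 'a vfield" where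
  "field_through A p x = (SOME X. X \<in> vector_fields A \<and> X p = x)"

text \<open>The curvature is tensorial, so its value at \<open>p\<close> does not depend on the fields chosen to
  extend the tangent vectors.\<close>

definition curvature_tensor ::
  "('a, 'e::euclidean_space) chart set \<Rightarrow> 'a metric_tensor \<Rightarrow> 'a connection \<Rightarrow>
   'a \<Rightarrow> 'a tvec \<Rightarrow> 'a tvec \<Rightarrow> 'a tvec \<Rightarrow> 'a tvec \<Rightarrow> real" where
  "curvature_tensor A g D p x y z u =
     g p (curvature D (field_through A p x) (field_through A p y) (field_through A p z) p) u"

definition holomorphic_sectional_curvature ::
  "('a, 'e::euclidean_space) chart set \<Rightarrow> 'a metric_tensor \<Rightarrow> 'a endo_field \<Rightarrow> 'a connection \<Rightarrow>
   'a \<Rightarrow> 'a tvec \<Rightarrow> real" where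
  "holomorphic_sectional_curvature A g J D p x =
     curvature_tensor A g D p x (J p x) (J p x) x"

definition pointwise_constant_hsc ::
  "('a, 'e::euclidean_space) chart set \<Rightarrow> 'a metric_tensor \<Rightarrow> 'a endo_field \<Rightarrow> 'a connection \<Rightarrow>
   bool" where
  "pointwise_constant_hsc A g J D \<longleftrightarrow>
     (\<forall>p. \<exists>k. \<forall>x\<in>tangent_space A p. g p x x = 1 \<or> g p x x = -1 \<longrightarrow>
        holomorphic_sectional_curvature A g J D p x = k)"

end

theory Submission
  imports Defs "HOL-Computational_Algebra.Polynomial" "HOL-Real_Asymp.Real_Asymp"
begin

text \<open>At a fixed point, \<open>Q(x) = R(x, J x, J x, x)\<close> is a quartic form with \<open>Q(x) = H(x)\<close> on unit vectors,
  and by homogeneity the hypothesis reads \<open>\<bar>Q(z)\<bar> \<le> c g(z, z)\<^sup>2\<close> wherever \<open>g(z, z) > 0\<close>. If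
  \<open>g(x, x) = 1\<close> and \<open>g(y, y) = -1\<close>, then \<open>g(x + t y, x + t y)\<close> is a quadratic polynomial in \<open>t\<close> with
  two real roots, and the bound makes both of them double roots of the quartic \<open>Q(x + t y)\<close>. Hence
  \<open>Q = k g\<^sup>2\<close> on the plane of \<open>x\<close> and \<open>y\<close>, so \<open>H(x) = k = H(y)\<close>. As \<open>x\<close> and \<open>y\<close> vary independently,
  \<open>H\<close> is constant on all unit vectors. No symmetry of \<open>R\<close> is involved, only its multilinearity, that
  is, the tensoriality of the curvature and the existence of global fields through a given vector.

  For these a bump function \<open>\<beta>\<close> supported in a chart suffices: every field \<open>X\<close> satisfies
  \<open>\<beta>\<^sup>3 X = \<Sum> (\<beta>\<^sup>2 X\<^sup>b) (\<beta> \<partial>\<^sub>b)\<close> with all coefficients and fields on the right global and smooth, where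
  \<open>\<beta>\<^sup>2 X\<^sup>b = \<beta> X(\<beta> y\<^sup>b) - \<beta> y\<^sup>b X(\<beta>)\<close>.\<close>

section \<open>Smooth maps and bump functions\<close>

lemma differentiable_on_at:
  assumes "open S" "f differentiable_on S" "x \<in> S"
  shows "f differentiable (at x)"
  using assms by (metis at_within_open differentiable_on_def)

text \<open>A derivative depends only on the values near the point, and openness of \<open>S\<close>
  makes agreement on \<open>S\<close> agreement near each of its points; so the induction passes to
  the derivatives.\<close>

lemma C_k_on_cong:
  assumes "open S" "\<And>x. x \<in> S \<Longrightarrow> f x = f' x" "C_k_on k S f"
  shows "C_k_on k S f'"
  using assms
proof (induction k arbitrary: f f')
  case 0
  then show ?case by (simp cong: continuous_on_cong)
next
  case (Suc k)
  have d: "f differentiable at x" if "x \<in> S" for x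
    using Suc.prems that by (auto intro: differentiable_on_at)
  have "f' differentiable_on S"
    using Suc.prems unfolding C_k_on.simps differentiable_on_def
    by (auto intro: differentiable_transform_within[where f = f, OF _ zero_less_one])
  moreover have "C_k_on k S (\<lambda>x. frechet_derivative f' (at x) v)" for v
  proof (rule Suc.IH)
    show "C_k_on k S (\<lambda>x. frechet_derivative f (at x) v)" using Suc.prems by simp
    show "frechet_derivative f (at x) v = frechet_derivative f' (at x) v" if "x \<in> S" for x
      by (simp add: frechet_derivative_transform_within_open[OF d[OF that] Suc.prems(1) that Suc.prems(2)])
  qed (fact Suc.prems)
  ultimately show ?case by simp
qed

lemma C_k_on_SucD:
  assumes "open S" "C_k_on (Suc k) S f"
  shows "C_k_on k S f"
  using assms
proof (induction k arbitrary: f)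
  case 0
  then show ?case by (simp add: differentiable_imp_continuous_on)
next
  case (Suc k)
  then show ?case by (metis C_k_on.simps(2))
qed

text \<open>For use with an explicit derivative \<open>f'\<close>, as the differentiation rules
  deliver it, instead of the term \<open>frechet_derivative\<close>.\<close>

lemma C_k_on_SucI:
  assumes "open S" "\<And>x. x \<in> S \<Longrightarrow> (f has_derivative f' x) (at x)"
    and "\<And>v. C_k_on k S (\<lambda>x. f' x v)"
  shows "C_k_on (Suc k) S f"
proof -
  have "f differentiable_on S"
    using assms(1,2) unfolding differentiable_on_def
    by (metis at_within_open differentiable_def)
  moreover have "C_k_on k S (\<lambda>x. frechet_derivative f (at x) v)" for v
    by (rule C_k_on_cong[OF assms(1) _ assms(3)[of v]])
      (use assms(2) frechet_derivative_at in metis)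
  ultimately show ?thesis by simp
qed

lemma C_k_on_SucE:
  assumes "open S" "C_k_on (Suc k) S f"
  obtains "\<And>x. x \<in> S \<Longrightarrow> (f has_derivative frechet_derivative f (at x)) (at x)"
    and "\<And>v. C_k_on k S (\<lambda>x. frechet_derivative f (at x) v)"
  using assms by (auto simp: frechet_derivative_works[symmetric] intro: differentiable_on_at)

lemma C_k_on_const: "open S \<Longrightarrow> C_k_on k S (\<lambda>x. c)"
  by (induction k arbitrary: c) (auto)

lemma C_k_on_add:
  assumes "open S" "C_k_on k S f" "C_k_on k S h"
  shows "C_k_on k S (\<lambda>x. f x + h x)"
  using assms
proof (induction k arbitrary: f h)
  case 0
  then show ?case by (simp add: continuous_on_add)
next
  case (Suc k)
  show ?case
    by (rule C_k_on_SucE[OF \<open>open S\<close> Suc.prems(2)], rule C_k_on_SucE[OF \<open>open S\<close> Suc.prems(3)],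
        rule C_k_on_SucI[OF \<open>open S\<close>, where f' = "\<lambda>x v. frechet_derivative f (at x) v + frechet_derivative h (at x) v"])
      (auto intro: has_derivative_add Suc.IH \<open>open S\<close>)
qed

lemma C_k_on_sum:
  assumes "open S" "finite I" "\<And>i. i \<in> I \<Longrightarrow> C_k_on k S (f i)"
  shows "C_k_on k S (\<lambda>x. \<Sum>i\<in>I. f i x)"
  using assms(2,3) by (induction I) (auto intro: C_k_on_add C_k_on_const assms(1))

lemma C_k_on_scaleR:
  fixes a :: "'e::euclidean_space \<Rightarrow> real"
  assumes "open S" "C_k_on k S a" "C_k_on k S f"
  shows "C_k_on k S (\<lambda>x. a x *\<^sub>R f x)"
  using assms
proof (induction k arbitrary: a f)
  case 0
  then show ?case by (simp add: continuous_on_scaleR)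
next
  case (Suc k)
  \<comment> \<open>The product rule leaves one factor undifferentiated in each summand, so both
    factors are also needed at order \<open>k\<close>.\<close>
  have af: "C_k_on k S a" "C_k_on k S f"
    using C_k_on_SucD \<open>open S\<close> Suc.prems by blast+
  show ?case
  proof (rule C_k_on_SucE[OF \<open>open S\<close> Suc.prems(2)], rule C_k_on_SucE[OF \<open>open S\<close> Suc.prems(3)],
      rule C_k_on_SucI[OF \<open>open S\<close>])
    assume a': "\<And>x. x \<in> S \<Longrightarrow> (a has_derivative frechet_derivative a (at x)) (at x)"
      "\<And>v. C_k_on k S (\<lambda>x. frechet_derivative a (at x) v)"
    assume f': "\<And>x. x \<in> S \<Longrightarrow> (f has_derivative frechet_derivative f (at x)) (at x)"
      "\<And>v. C_k_on k S (\<lambda>x. frechet_derivative f (at x) v)"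
    show "((\<lambda>x. a x *\<^sub>R f x) has_derivative (\<lambda>v. a x *\<^sub>R frechet_derivative f (at x) v
        + frechet_derivative a (at x) v *\<^sub>R f x)) (at x)" if "x \<in> S" for x
      by (rule has_derivative_scaleR[OF a'(1)[OF that] f'(1)[OF that]])
    show "C_k_on k S (\<lambda>x. a x *\<^sub>R frechet_derivative f (at x) v
        + frechet_derivative a (at x) v *\<^sub>R f x)" for v
      by (rule C_k_on_add[OF \<open>open S\<close> Suc.IH[OF \<open>open S\<close> af(1) f'(2)] Suc.IH[OF \<open>open S\<close> a'(2) af(2)]])
  qed
qed

lemma C_k_on_bounded_linear:
  assumes "open S" "bounded_linear l" "C_k_on k S f"
  shows "C_k_on k S (\<lambda>x. l (f x))"
  using assms
proof (induction k arbitrary: f)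
  case 0
  then show ?case by (simp add: bounded_linear.continuous_on)
next
  case (Suc k)
  show ?case
    by (rule C_k_on_SucE[OF \<open>open S\<close> Suc.prems(3)],
        rule C_k_on_SucI[OF \<open>open S\<close>, where f' = "\<lambda>x v. l (frechet_derivative f (at x) v)"])
      (auto intro: bounded_linear.has_derivative[OF assms(2)] Suc.IH assms(1,2))
qed

lemma C_k_on_id: "open S \<Longrightarrow> C_k_on k S (\<lambda>x. x)"
proof (cases k)
  case (Suc n)
  assume "open S"
  then show ?thesis unfolding Suc
    by (intro C_k_on_SucI[where f' = "\<lambda>x v. v"]) (auto intro: C_k_on_const)
qed simp

lemma C_k_on_compose:
  fixes f :: "'f::euclidean_space \<Rightarrow> 'h::real_normed_vector" and h :: "'e::euclidean_space \<Rightarrow> 'f"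
  assumes "open S" "open T" "h ` S \<subseteq> T" "C_k_on k T f" "C_k_on k S h"
  shows "C_k_on k S (\<lambda>x. f (h x))"
  using assms(4,5)
proof (induction k arbitrary: f)
  case 0
  then show ?case using assms(3) by (auto intro: continuous_on_compose2)
next
  case (Suc k)
  let ?f' = "\<lambda>x. frechet_derivative f (at x)" and ?h' = "\<lambda>x. frechet_derivative h (at x)"
  have hk: "C_k_on k S h" by (rule C_k_on_SucD[OF assms(1) Suc.prems(2)])
  have f': "\<And>x. x \<in> T \<Longrightarrow> (f has_derivative ?f' x) (at x)" "\<And>v. C_k_on k T (\<lambda>x. ?f' x v)"
    by (rule C_k_on_SucE[OF assms(2) Suc.prems(1)]; blast)+
  have h': "\<And>x. x \<in> S \<Longrightarrow> (h has_derivative ?h' x) (at x)" "\<And>v. C_k_on k S (\<lambda>x. ?h' x v)"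
    by (rule C_k_on_SucE[OF assms(1) Suc.prems(2)]; blast)+
  \<comment> \<open>The chain rule evaluates \<open>?f' (h x)\<close> on a vector that moves with
    \<open>x\<close>, whereas \<open>C_k_on\<close> speaks of fixed directions. Expanding the vector
    in the basis leaves products of functions of class \<open>k\<close>.\<close>
  have eq: "(\<Sum>b\<in>Basis. (?h' x v \<bullet> b) *\<^sub>R ?f' (h x) b) = ?f' (h x) (?h' x v)" if "x \<in> S" for x v
  proof -
    have "linear (?f' (h x))"
      using f'(1)[of "h x"] assms(3) that has_derivative_linear by blast
    then show ?thesis
      by (subst (2) euclidean_representation[symmetric]) (simp add: linear_sum linear_scale)
  qed
  show ?case
  proof (rule C_k_on_SucI[OF assms(1)])
    show "((\<lambda>x. f (h x)) has_derivative (\<lambda>v. ?f' (h x) (?h' x v))) (at x)" if "x \<in> S" for x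
      using f'(1)[of "h x"] h'(1)[OF that] assms(3) that
      by (auto intro: has_derivative_compose)
    have "C_k_on k S (\<lambda>x. \<Sum>b\<in>Basis. (?h' x v \<bullet> b) *\<^sub>R ?f' (h x) b)" for v
      by (intro C_k_on_sum C_k_on_scaleR assms Suc.IH f' hk finite_Basis
          C_k_on_bounded_linear[OF assms(1) bounded_linear_inner_left] h')
    then show "C_k_on k S (\<lambda>x. ?f' (h x) (?h' x v))" for v
      by (rule C_k_on_cong[OF assms(1), rotated]) (rule eq)
  qed
qed

lemma C_k_on_subset:
  assumes "C_k_on k S f" "T \<subseteq> S"
  shows "C_k_on k T f"
  using assms(1)
  by (induction k arbitrary: f)
    (use assms(2) continuous_on_subset differentiable_on_subset in auto)

text \<open>Being of class \<open>k\<close> is a local property; this glues a function from open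
  pieces.\<close>

lemma C_k_on_Union:
  assumes "\<And>T. T \<in> \<T> \<Longrightarrow> open T" "\<And>T. T \<in> \<T> \<Longrightarrow> C_k_on k T f"
  shows "C_k_on k (\<Union>\<T>) f"
  using assms(2)
proof (induction k arbitrary: f)
  case 0
  then show ?case using assms(1) by (simp add: continuous_on_open_Union)
next
  case (Suc k)
  moreover have "f differentiable_on \<Union>\<T>"
    using Suc.prems assms(1) unfolding differentiable_on_def
    by (metis C_k_on.simps(2) Union_iff at_within_open differentiable_on_at open_Union)
  ultimately show ?case by simp
qed

section \<open>Closure properties of smooth maps\<close>

lemma smooth_on_cong:
  "open S \<Longrightarrow> (\<And>x. x \<in> S \<Longrightarrow> f x = h x) \<Longrightarrow> smooth_on S f \<Longrightarrow> smooth_on S h"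
  unfolding smooth_on_def by (blast intro: C_k_on_cong)

lemma smooth_on_const: "open S \<Longrightarrow> smooth_on S (\<lambda>x. c)"
  by (simp add: smooth_on_def C_k_on_const)

lemma smooth_on_id: "open S \<Longrightarrow> smooth_on S (\<lambda>x. x)"
  by (simp add: smooth_on_def C_k_on_id)

lemma smooth_on_add:
  "open S \<Longrightarrow> smooth_on S f \<Longrightarrow> smooth_on S h \<Longrightarrow> smooth_on S (\<lambda>x. f x + h x)"
  by (simp add: smooth_on_def C_k_on_add)

lemma smooth_on_mult:
  fixes f h :: "'e::euclidean_space \<Rightarrow> real"
  shows "open S \<Longrightarrow> smooth_on S f \<Longrightarrow> smooth_on S h \<Longrightarrow> smooth_on S (\<lambda>x. f x * h x)"
  using C_k_on_scaleR[of S _ f h] by (simp add: smooth_on_def)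

lemma smooth_on_inner:
  assumes "open S" "smooth_on S f"
  shows "smooth_on S (\<lambda>x. f x \<bullet> b)"
  unfolding smooth_on_def
  using assms(2) by (auto simp: smooth_on_def intro!: C_k_on_bounded_linear[OF assms(1) bounded_linear_inner_left])

lemma smooth_on_norm_sq:
  fixes f :: "'e::euclidean_space \<Rightarrow> 'f::euclidean_space"
  assumes "open S" "smooth_on S f"
  shows "smooth_on S (\<lambda>x. f x \<bullet> f x)"
proof -
  have "smooth_on S (\<lambda>x. \<Sum>b\<in>Basis. (f x \<bullet> b) * (f x \<bullet> b))"
    using smooth_on_mult[OF assms(1) smooth_on_inner[OF assms] smooth_on_inner[OF assms]]
    unfolding smooth_on_def by (auto intro: C_k_on_sum assms(1))
  then show ?thesis by (simp add: euclidean_inner[symmetric])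
qed

lemma smooth_on_compose:
  fixes f :: "'f::euclidean_space \<Rightarrow> 'h::real_normed_vector" and h :: "'e::euclidean_space \<Rightarrow> 'f"
  shows "open S \<Longrightarrow> open T \<Longrightarrow> h ` S \<subseteq> T \<Longrightarrow> smooth_on T f \<Longrightarrow> smooth_on S h \<Longrightarrow>
    smooth_on S (\<lambda>x. f (h x))"
  unfolding smooth_on_def by (blast intro: C_k_on_compose)

lemma smooth_on_subset: "smooth_on S f \<Longrightarrow> T \<subseteq> S \<Longrightarrow> smooth_on T f"
  unfolding smooth_on_def by (blast intro: C_k_on_subset)

lemma smooth_on_Un:
  assumes "open S" "open T" "smooth_on S f" "smooth_on T f"
  shows "smooth_on (S \<union> T) f"
  using C_k_on_Union[of "{S, T}" _ f] assms by (auto simp: smooth_on_def)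

lemma smooth_on_directional_derivative:
  "smooth_on S f \<Longrightarrow> smooth_on S (\<lambda>x. frechet_derivative f (at x) v)"
  unfolding smooth_on_def by (metis C_k_on.simps(2))

lemma smooth_on_has_derivative:
  assumes "open S" "smooth_on S f" "x \<in> S"
  shows "(f has_derivative frechet_derivative f (at x)) (at x)"
  using assms C_k_on_SucE[of S 0 f] unfolding smooth_on_def by blast

text \<open>Closed under differentiation, since every derivative of \<open>exp (- 1 / t)\<close> is a polynomial in
  \<open>1 / t\<close> times \<open>exp (- 1 / t)\<close>.\<close>

definition flat_exp :: "real poly \<Rightarrow> real \<Rightarrow> real" where
  "flat_exp P t = (if t > 0 then poly P (1 / t) * exp (- 1 / t) else 0)"

text \<open>Substituting \<open>x = 1 / t\<close> moves the limit to infinity, where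
  \<open>exp (- x)\<close> beats each monomial of \<open>P\<close>.\<close>

lemma flat_exp_tendsto_0: "(flat_exp P \<longlongrightarrow> 0) (at_right 0)"
proof -
  have "((\<lambda>x::real. x ^ n * exp (- x)) \<longlongrightarrow> 0) at_top" for n
    by real_asymp
  then have "((\<lambda>x. \<Sum>i\<le>degree P. coeff P i * (x ^ i * exp (- x))) \<longlongrightarrow> (\<Sum>i\<le>degree P. coeff P i * 0)) at_top"
    by (intro tendsto_sum tendsto_mult tendsto_const)
  then have "((\<lambda>x. poly P x * exp (- x)) \<longlongrightarrow> 0) at_top"
    by (simp add: poly_altdef sum_distrib_right mult.assoc)
  then have "((\<lambda>t. poly P (1 / t) * exp (- (1 / t))) \<longlongrightarrow> 0) (at_right 0)"
    by (rule filterlim_compose) (real_asymp)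
  then show ?thesis
    by (rule Lim_transform_eventually)
      (auto simp: flat_exp_def eventually_at_filter)
qed

text \<open>With \<open>x = 1 / t\<close> one has \<open>dx/dt = - x^2\<close>, so
  \<open>P(x) exp(-x)\<close> has the derivative \<open>(P(x) - P'(x)) x^2 exp(-x)\<close>; the
  factor \<open>x^2\<close> is \<open>[:0, 0, 1:]\<close>.\<close>

lemma flat_exp_has_real_derivative:
  "(flat_exp P has_real_derivative flat_exp ((P - pderiv P) * [:0, 0, 1:]) t) (at t)"
proof (cases "t = 0" "t > 0" rule: bool.exhaust[case_product bool.exhaust])
  case True_True
  then show ?thesis by simp
next
  case True_False
  \<comment> \<open>At \<open>0\<close> the difference quotient is itself a \<open>flat_exp\<close>,
    for the polynomial \<open>x P(x)\<close>, so the limit just proved applies to it.\<close>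
  have eq: "flat_exp P h / h = flat_exp (P * [:0, 1:]) h" for h
    by (simp add: flat_exp_def)
  have "((\<lambda>h. flat_exp P h / h) \<longlongrightarrow> 0) (at 0)"
    unfolding eq
  proof (subst filterlim_at_split, intro conjI flat_exp_tendsto_0)
    show "(flat_exp (P * [:0, 1:]) \<longlongrightarrow> 0) (at_left 0)"
      by (rule Lim_transform_eventually[OF tendsto_const])
        (auto simp: flat_exp_def eventually_at_filter)
  qed
  then show ?thesis using True_False
    by (simp add: has_field_derivative_iff flat_exp_def)
next
  case False_True
  have "((\<lambda>t. poly P (1 / t) * exp (- 1 / t)) has_real_derivative
      flat_exp ((P - pderiv P) * [:0, 0, 1:]) t) (at t)"
    using False_True
    by (auto intro!: derivative_eq_intros DERIV_chain2[OF poly_DERIV] simp: flat_exp_def field_simps power2_eq_square)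
  then show ?thesis
    by (rule has_field_derivative_transform_within_open[where S = "{0<..}"])
      (use False_True in \<open>auto simp: flat_exp_def\<close>)
next
  case False_False
  then have "t < 0" by simp
  have "((\<lambda>t. 0) has_real_derivative flat_exp ((P - pderiv P) * [:0, 0, 1:]) t) (at t)"
    using \<open>t < 0\<close> by (simp add: flat_exp_def)
  then show ?thesis
    by (rule has_field_derivative_transform_within_open[where S = "{..<0}"])
      (use \<open>t < 0\<close> in \<open>auto simp: flat_exp_def\<close>)
qed

lemma smooth_on_flat_exp: "smooth_on UNIV (flat_exp P)"
  unfolding smooth_on_def
proof
  show "C_k_on k UNIV (flat_exp P)" for k
  proof (induction k arbitrary: P)
    case 0
    then show ?case
      using flat_exp_has_real_derivative DERIV_isCont
      by (simp add: continuous_on_eq_continuous_at) blast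
  next
    case (Suc k)
    show ?case
    proof (rule C_k_on_SucI)
      show "(flat_exp P has_derivative (\<lambda>v. flat_exp ((P - pderiv P) * [:0, 0, 1:]) t * v)) (at t)" for t
        using flat_exp_has_real_derivative has_field_derivative_imp_has_derivative by blast
      show "C_k_on k UNIV (\<lambda>t. flat_exp ((P - pderiv P) * [:0, 0, 1:]) t * v)" for v
        unfolding real_scaleR_def[symmetric]
        by (rule C_k_on_scaleR[OF open_UNIV Suc.IH C_k_on_const[OF open_UNIV]])
    qed simp
  qed
qed

text \<open>The function \<open>exp (- 1 / t)\<close>, continued by zero to
  \<open>t \<le> 0\<close>, is evaluated at \<open>r^2 - |y - y0|^2\<close>, which is positive at
  the centre and negative outside the closed ball.\<close>

lemma bump_function_exists:
  fixes y0 :: "'e::euclidean_space"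
  assumes "r > 0"
  obtains \<beta> :: "'e \<Rightarrow> real" where "smooth_on UNIV \<beta>" "\<beta> y0 \<noteq> 0" "\<And>y. y \<notin> cball y0 r \<Longrightarrow> \<beta> y = 0"
proof
  \<comment> \<open>Differences are spelled as sums with \<open>- 1\<close> and \<open>- y0\<close>,
    so that the closure rules for sums and products match.\<close>
  let ?\<beta> = "\<lambda>y. flat_exp 1 (r\<^sup>2 + (- 1) * ((y + (- y0)) \<bullet> (y + (- y0))))"
  show "smooth_on UNIV ?\<beta>"
    by (intro smooth_on_compose[OF _ _ _ smooth_on_flat_exp] smooth_on_const smooth_on_id
        smooth_on_norm_sq smooth_on_add smooth_on_mult open_UNIV subset_UNIV)
  show "?\<beta> y0 \<noteq> 0" using assms by (simp add: flat_exp_def)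
  show "?\<beta> y = 0" if "y \<notin> cball y0 r" for y
  proof -
    have "r < norm (y - y0)" using that by (simp add: dist_norm norm_minus_commute)
    then have "r\<^sup>2 < (norm (y - y0))\<^sup>2" using assms by (intro power_strict_mono) auto
    then show ?thesis by (simp add: flat_exp_def dot_square_norm)
  qed
qed

section \<open>Vector fields on manifolds\<close>

locale smooth_manifold =
  fixes A :: "('a::{t2_space, second_countable_topology}, 'e::euclidean_space) chart set"
  assumes atlas: "smooth_atlas A"
begin

section \<open>Charts and the algebra of smooth functions\<close>

lemma chart:
  assumes "(U, \<phi>) \<in> A"
  shows "open U" "open (\<phi> ` U)" "homeomorphism U (\<phi> ` U) \<phi> (inv_into U \<phi>)"
  using assms atlas by (auto simp: smooth_atlas_def is_chart_def)

lemma chart_inv [simp]: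
  assumes "(U, \<phi>) \<in> A" "q \<in> U"
  shows "inv_into U \<phi> (\<phi> q) = q"
  using chart(3)[OF assms(1)] assms(2) by (rule homeomorphism_apply1)

lemma chart_open_image:
  assumes "(U, \<phi>) \<in> A" "open W" "W \<subseteq> U"
  shows "open (\<phi> ` W)"
proof -
  have "openin (top_of_set (\<phi> ` U)) (\<phi> ` W)"
    by (rule homeomorphism_imp_open_map[OF chart(3)[OF assms(1)]])
      (use assms chart(1)[OF assms(1)] in \<open>simp add: openin_open_eq\<close>)
  then show ?thesis using chart(2)[OF assms(1)] by (simp add: openin_open_eq)
qed

lemma transition_smooth:
  assumes "(U, \<phi>) \<in> A" "(V, \<psi>) \<in> A"
  shows "smooth_on (\<phi> ` (U \<inter> V)) (\<lambda>y. \<psi> (inv_into U \<phi> y))"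
proof -
  have "\<forall>(U, \<phi>)\<in>A. \<forall>(V, \<psi>)\<in>A. smooth_on (\<phi> ` (U \<inter> V)) (\<psi> \<circ> inv_into U \<phi>)"
    using atlas by (simp add: smooth_atlas_def)
  from bspec[OF bspec[OF this assms(1), unfolded prod.case] assms(2), unfolded prod.case]
  show ?thesis unfolding comp_def .
qed

lemma smooth_functionsD:
  "f \<in> smooth_functions A \<Longrightarrow> (U, \<phi>) \<in> A \<Longrightarrow> smooth_on (\<phi> ` U) (\<lambda>y. f (inv_into U \<phi> y))"
  by (auto simp: smooth_functions_def comp_def)

lemma smooth_functionsI:
  "(\<And>U \<phi>. (U, \<phi>) \<in> A \<Longrightarrow> smooth_on (\<phi> ` U) (\<lambda>y. f (inv_into U \<phi> y))) \<Longrightarrow> f \<in> smooth_functions A"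
  by (auto simp: smooth_functions_def comp_def)

lemma smooth_functions_const: "(\<lambda>q. c) \<in> smooth_functions A"
  by (rule smooth_functionsI, rule smooth_on_const, rule chart(2))

lemma smooth_functions_add:
  "f \<in> smooth_functions A \<Longrightarrow> h \<in> smooth_functions A \<Longrightarrow> (\<lambda>q. f q + h q) \<in> smooth_functions A"
  by (rule smooth_functionsI, rule smooth_on_add) (auto intro: chart(2) smooth_functionsD)

lemma smooth_functions_mult:
  "f \<in> smooth_functions A \<Longrightarrow> h \<in> smooth_functions A \<Longrightarrow> (\<lambda>q. f q * h q) \<in> smooth_functions A"
  by (rule smooth_functionsI, rule smooth_on_mult) (auto intro: chart(2) smooth_functionsD)

lemma smooth_functions_uminus:
  assumes "f \<in> smooth_functions A"
  shows "(\<lambda>q. - f q) \<in> smooth_functions A"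
  using smooth_functions_mult[OF smooth_functions_const[of "-1"] assms] by simp

lemma smooth_functions_diff:
  assumes "f \<in> smooth_functions A" "h \<in> smooth_functions A"
  shows "(\<lambda>q. f q - h q) \<in> smooth_functions A"
  using smooth_functions_add[OF assms(1) smooth_functions_mult[OF smooth_functions_const[of "-1"] assms(2)]]
  by simp

text \<open>In another chart with domain \<open>V\<close> the function is \<open>w\<close> after a
  transition map on \<open>U \<inter> V\<close>, and zero on \<open>V - C\<close>, where
  \<open>C\<close> is the compact set corresponding to \<open>K\<close>. In a Hausdorff space
  \<open>C\<close> is closed, so both pieces are open, and they cover \<open>V\<close> because
  \<open>C\<close> lies in \<open>U\<close>.\<close>

lemma extension_by_zero_smooth:
  assumes c: "(U, \<phi>) \<in> A" and w: "smooth_on (\<phi> ` U) w"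
    and K: "compact K" "K \<subseteq> \<phi> ` U" "\<And>y. y \<notin> K \<Longrightarrow> w y = 0"
  shows "(\<lambda>q. if q \<in> U then w (\<phi> q) else 0) \<in> smooth_functions A"
proof (rule smooth_functionsI)
  fix V \<psi> assume d: "(V, \<psi>) \<in> A"
  define C where "C = inv_into U \<phi> ` K"
  let ?G = "\<lambda>q. if q \<in> U then w (\<phi> q) else 0"
  have "compact C" unfolding C_def
    using homeomorphism_cont2[OF chart(3)[OF c]] K(1,2)
    by (blast intro: compact_continuous_image continuous_on_subset)
  then have o: "open (\<psi> ` (U \<inter> V))" "open (\<psi> ` (V - C))"
    using chart(1)[OF c] chart(1)[OF d]
    by (auto intro!: chart_open_image[OF d] open_Diff compact_imp_closed)
  have "C \<subseteq> U" unfolding C_def using K(2) by (auto simp: c)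
  have "smooth_on (\<psi> ` (U \<inter> V)) (\<lambda>y. w (\<phi> (inv_into V \<psi> y)))"
  proof (rule smooth_on_compose[OF o(1) chart(2)[OF c] _ w])
    show "smooth_on (\<psi> ` (U \<inter> V)) (\<lambda>y. \<phi> (inv_into V \<psi> y))"
      using transition_smooth[OF d c] by (simp add: Int_commute)
  qed (auto simp: d)
  then have s1: "smooth_on (\<psi> ` (U \<inter> V)) (\<lambda>y. ?G (inv_into V \<psi> y))"
    by (rule smooth_on_cong[OF o(1), rotated]) (auto simp: d)
  have s2: "smooth_on (\<psi> ` (V - C)) (\<lambda>y. ?G (inv_into V \<psi> y))"
  proof (rule smooth_on_cong[OF o(2) _ smooth_on_const[OF o(2)]])
    fix y assume "y \<in> \<psi> ` (V - C)"
    then obtain q where q: "q \<in> V" "q \<notin> C" "y = \<psi> q" by blast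
    have "w (\<phi> q) = 0" if "q \<in> U"
      using that q(2) K(3) unfolding C_def by (metis c chart_inv image_eqI)
    then show "0 = ?G (inv_into V \<psi> y)" using q d by simp
  qed
  have "\<psi> ` (U \<inter> V) \<union> \<psi> ` (V - C) = \<psi> ` V" using \<open>C \<subseteq> U\<close> by blast
  then show "smooth_on (\<psi> ` V) (\<lambda>y. ?G (inv_into V \<psi> y))"
    using smooth_on_Un[OF o s1 s2] by simp
qed

section \<open>Tangent spaces and the module of vector fields\<close>

lemma tangent_space_zero: "(\<lambda>f. 0) \<in> tangent_space A p"
  by (simp add: tangent_space_def)

lemma tangent_space_tadd:
  "x \<in> tangent_space A p \<Longrightarrow> y \<in> tangent_space A p \<Longrightarrow> tadd x y \<in> tangent_space A p"
  by (simp add: tangent_space_def tadd_def algebra_simps)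

lemma tangent_space_tscale:
  "x \<in> tangent_space A p \<Longrightarrow> tscale a x \<in> tangent_space A p"
  by (simp add: tangent_space_def tscale_def algebra_simps)

lemma vector_fieldsD:
  assumes "X \<in> vector_fields A"
  shows "X p \<in> tangent_space A p"
    "f \<in> smooth_functions A \<Longrightarrow> (\<lambda>p. X p f) \<in> smooth_functions A"
  using assms by (auto simp: vector_fields_def)

lemma vector_fields_zero: "(\<lambda>p f. 0) \<in> vector_fields A"
  by (simp add: vector_fields_def tangent_space_zero smooth_functions_const)

lemma vector_fields_vadd:
  "X \<in> vector_fields A \<Longrightarrow> Y \<in> vector_fields A \<Longrightarrow> vadd X Y \<in> vector_fields A"
  by (simp add: vector_fields_def vadd_def tangent_space_tadd) (simp add: tadd_def smooth_functions_add)

lemma vector_fields_vscale: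
  "f \<in> smooth_functions A \<Longrightarrow> X \<in> vector_fields A \<Longrightarrow> vscale f X \<in> vector_fields A"
  by (simp add: vector_fields_def vscale_def tangent_space_tscale) (simp add: tscale_def smooth_functions_mult)

text \<open>Lets the rules for \<open>vadd\<close> and \<open>vscale\<close> handle differences
  too.\<close>

lemma vdiff_eq: "vdiff X Y = vadd X (vscale (\<lambda>p. - 1) Y)"
  by (simp add: vdiff_def vadd_def vscale_def)

text \<open>The derivation at \<open>q\<close> with constant coordinates \<open>w\<close> in the
  chart. The default \<open>0\<close> off the smooth functions is the one that
  \<open>tangent_space\<close> prescribes.\<close>

definition coord_vector :: "'a set \<Rightarrow> ('a \<Rightarrow> 'e) \<Rightarrow> 'a \<Rightarrow> 'e \<Rightarrow> 'a tvec" where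
  "coord_vector U \<phi> q w = (\<lambda>f. if f \<in> smooth_functions A
     then frechet_derivative (\<lambda>y. f (inv_into U \<phi> y)) (at (\<phi> q)) w else 0)"

lemma smooth_function_has_derivative:
  assumes "(U, \<phi>) \<in> A" "q \<in> U" "f \<in> smooth_functions A"
  shows "((\<lambda>y. f (inv_into U \<phi> y)) has_derivative (\<lambda>w. coord_vector U \<phi> q w f)) (at (\<phi> q))"
  using smooth_on_has_derivative[OF chart(2)[OF assms(1)] smooth_functionsD[OF assms(3,1)], of "\<phi> q"] assms
  by (simp add: coord_vector_def)

lemma coord_vector_unique:
  assumes "f \<in> smooth_functions A" "((\<lambda>y. f (inv_into U \<phi> y)) has_derivative f') (at (\<phi> q))"
  shows "coord_vector U \<phi> q w f = f' w"
  using frechet_derivative_at[OF assms(2)] assms(1) by (simp add: coord_vector_def)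

lemma coord_vector_in_tangent_space:
  assumes c: "(U, \<phi>) \<in> A" and "q \<in> U"
  shows "coord_vector U \<phi> q w \<in> tangent_space A q"
  unfolding tangent_space_def
proof (intro CollectI conjI allI ballI impI)
  fix f h :: "'a \<Rightarrow> real" and a :: real
  note d = smooth_function_has_derivative[OF assms]
  show "coord_vector U \<phi> q w f = 0" if "f \<notin> smooth_functions A"
    using that by (simp add: coord_vector_def)
  assume f: "f \<in> smooth_functions A"
  show "coord_vector U \<phi> q w (\<lambda>q. a * f q) = a * coord_vector U \<phi> q w f"
    by (intro coord_vector_unique smooth_functions_mult smooth_functions_const f
        has_derivative_mult_right[OF d])
  assume h: "h \<in> smooth_functions A"
  show "coord_vector U \<phi> q w (\<lambda>q. f q + h q) = coord_vector U \<phi> q w f + coord_vector U \<phi> q w h"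
    by (intro coord_vector_unique smooth_functions_add f h has_derivative_add[OF d d])
  have "coord_vector U \<phi> q w (\<lambda>q. f q * h q) =
      f (inv_into U \<phi> (\<phi> q)) * coord_vector U \<phi> q w h + coord_vector U \<phi> q w f * h (inv_into U \<phi> (\<phi> q))"
    by (intro coord_vector_unique smooth_functions_mult f h has_derivative_mult[OF d d])
  then show "coord_vector U \<phi> q w (\<lambda>q. f q * h q) = coord_vector U \<phi> q w f * h q + f q * coord_vector U \<phi> q w h"
    using assms by simp
qed

lemma coord_vector_linear:
  assumes "(U, \<phi>) \<in> A" "q \<in> U"
  shows "linear (\<lambda>w. coord_vector U \<phi> q w f)"
proof (cases "f \<in> smooth_functions A")
  case True
  then show ?thesis using has_derivative_linear[OF smooth_function_has_derivative[OF assms]] by simp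
next
  case False
  then show ?thesis by (simp add: coord_vector_def linear_zero)
qed

end

text \<open>Coordinates on the tangent spaces make their dimension that of the model space, so that
  coordinate vectors span by counting.\<close>

locale smooth_manifold_coordinates = smooth_manifold A
  for A :: "('a::{t2_space, second_countable_topology}, 'e::euclidean_space) chart set" +
  assumes tangent_coordinates: "\<exists>L. bij_betw L (coord_space DIM('e)) (tangent_space A p) \<and>
     (\<forall>u\<in>coord_space DIM('e). \<forall>v\<in>coord_space DIM('e). L (\<lambda>i. u i + v i) = tadd (L u) (L v)) \<and>
     (\<forall>u\<in>coord_space DIM('e). \<forall>a. L (\<lambda>i. a * u i) = tscale a (L u))"

text \<open>A chart with a smooth function supported in a compact part of its image: expressions in
  coordinates, once multiplied by \<open>\<beta>\<close>, extend by zero to the whole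
  manifold.\<close>

locale bump_chart = smooth_manifold_coordinates A
  for A :: "('a::{t2_space, second_countable_topology}, 'e::euclidean_space) chart set" +
  fixes U :: "'a set" and \<phi> :: "'a \<Rightarrow> 'e" and K :: "'e set" and \<beta> :: "'e \<Rightarrow> real"
  assumes chart_in_atlas: "(U, \<phi>) \<in> A"
    and compact_support: "compact K" "K \<subseteq> \<phi> ` U" "\<And>y. y \<notin> K \<Longrightarrow> \<beta> y = 0"
    and smooth_bump: "smooth_on UNIV \<beta>"
begin

section \<open>Cut-off coordinates and coordinate fields on the whole manifold\<close>

definition bump :: "'a \<Rightarrow> real" where
  "bump q = (if q \<in> U then \<beta> (\<phi> q) else 0)"

definition cutoff_coord :: "'e \<Rightarrow> 'a \<Rightarrow> real" where
  "cutoff_coord b q = (if q \<in> U then \<beta> (\<phi> q) * (\<phi> q \<bullet> b) else 0)"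

definition coord_field :: "'e \<Rightarrow> 'a vfield" where
  "coord_field w = (\<lambda>q f. if q \<in> U then \<beta> (\<phi> q) * coord_vector U \<phi> q w f else 0)"

lemma bump_on_chart: "smooth_on (\<phi> ` U) \<beta>"
  using smooth_on_subset[OF smooth_bump] by blast

lemma bump_smooth: "bump \<in> smooth_functions A"
  unfolding bump_def
  by (rule extension_by_zero_smooth[OF chart_in_atlas bump_on_chart compact_support])

lemma cutoff_coord_smooth: "cutoff_coord b \<in> smooth_functions A"
  unfolding cutoff_coord_def
  by (rule extension_by_zero_smooth[OF chart_in_atlas _ compact_support(1,2)])
    (auto simp: compact_support
      intro!: smooth_on_mult[OF _ bump_on_chart] smooth_on_inner smooth_on_id chart[OF chart_in_atlas])

lemma coord_field_in_vector_fields: "coord_field w \<in> vector_fields A"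
  unfolding vector_fields_def
proof (intro CollectI conjI allI ballI)
  show "coord_field w q \<in> tangent_space A q" for q
    using tangent_space_zero tangent_space_tscale[OF coord_vector_in_tangent_space[OF chart_in_atlas]]
    by (cases "q \<in> U") (simp_all add: coord_field_def tscale_def)
  fix f assume f: "f \<in> smooth_functions A"
  have "smooth_on (\<phi> ` U) (\<lambda>y. \<beta> y * frechet_derivative (\<lambda>y. f (inv_into U \<phi> y)) (at y) w)"
    by (intro smooth_on_mult bump_on_chart smooth_on_directional_derivative
        smooth_functionsD[OF f chart_in_atlas] chart[OF chart_in_atlas])
  from extension_by_zero_smooth[OF chart_in_atlas this compact_support(1,2)]
  show "(\<lambda>q. coord_field w q f) \<in> smooth_functions A"
    using f by (simp add: coord_field_def coord_vector_def compact_support cong: if_cong)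
qed

text \<open>For \<open>X = \<Sum> X\<^sup>b \<partial>\<^sub>b\<close> this is \<open>bump\<^sup>2 X\<^sup>b\<close>, in a form that is visibly smooth on the whole manifold.\<close>

definition component :: "'a vfield \<Rightarrow> 'e \<Rightarrow> 'a \<Rightarrow> real" where
  "component X b q = bump q * X q (cutoff_coord b) - cutoff_coord b q * X q bump"

lemma component_smooth: "X \<in> vector_fields A \<Longrightarrow> component X b \<in> smooth_functions A"
  unfolding component_def
  using bump_smooth cutoff_coord_smooth vector_fieldsD(2)
  by (intro smooth_functions_diff smooth_functions_mult) blast+

text \<open>By the Leibniz rule \<open>X(\<beta> y^b) = \<beta> w^b + y^b X(\<beta>)\<close>. After
  multiplication by \<open>\<beta>\<close> the last term cancels against the one subtracted in
  \<open>component\<close>.\<close>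

lemma component_coord_vector:
  assumes "q \<in> U" "X q = coord_vector U \<phi> q w"
  shows "component X b q = (bump q)\<^sup>2 * (w \<bullet> b)"
proof -
  have o: "open (\<phi> ` U)" and q: "\<phi> q \<in> \<phi> ` U"
    using chart[OF chart_in_atlas] assms by auto
  have d\<beta>: "(\<beta> has_derivative frechet_derivative \<beta> (at (\<phi> q))) (at (\<phi> q))"
    using smooth_on_has_derivative[OF _ smooth_bump] by simp
  have d1: "coord_vector U \<phi> q w bump = frechet_derivative \<beta> (at (\<phi> q)) w"
    by (rule coord_vector_unique[OF bump_smooth], rule has_derivative_transform_within_open[OF d\<beta> o q])
      (auto simp: bump_def chart_in_atlas)
  have "((\<lambda>y. \<beta> y * (y \<bullet> b)) has_derivative
      (\<lambda>w. \<beta> (\<phi> q) * (w \<bullet> b) + frechet_derivative \<beta> (at (\<phi> q)) w * (\<phi> q \<bullet> b))) (at (\<phi> q))"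
    by (intro has_derivative_mult d\<beta> has_derivative_inner_left has_derivative_ident)
  then have d2: "coord_vector U \<phi> q w (cutoff_coord b) =
      \<beta> (\<phi> q) * (w \<bullet> b) + frechet_derivative \<beta> (at (\<phi> q)) w * (\<phi> q \<bullet> b)"
    by (intro coord_vector_unique[OF cutoff_coord_smooth], elim has_derivative_transform_within_open[OF _ o q])
      (auto simp: cutoff_coord_def chart_in_atlas)
  show ?thesis
    unfolding component_def assms(2) d1 d2 using assms(1)
    by (simp add: bump_def cutoff_coord_def power2_eq_square algebra_simps)
qed

text \<open>One and the same field is read with coordinates \<open>w\<close> and with coordinates
  \<open>v\<close>; its components divided by \<open>(bump q)^2\<close> must give both.\<close>

lemma coord_vector_inj:
  assumes "q \<in> U" "bump q \<noteq> 0" "coord_vector U \<phi> q w = coord_vector U \<phi> q v"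
  shows "w = v"
proof (rule euclidean_eqI)
  fix b :: 'e
  show "w \<bullet> b = v \<bullet> b"
    using component_coord_vector[OF assms(1), of "\<lambda>q. coord_vector U \<phi> q w" w b]
      component_coord_vector[OF assms(1), of "\<lambda>q. coord_vector U \<phi> q w" v b] assms(2,3)
    by simp
qed

text \<open>A dimension count: tangent coordinates give an injection \<open>G\<close> of the tangent
  space into the model space, so \<open>w \<mapsto> G (?c w)\<close> is an injective linear
  endomorphism of a finite-dimensional space, hence onto.\<close>

lemma coord_vector_surj:
  assumes q: "q \<in> U" "bump q \<noteq> 0" and x: "x \<in> tangent_space A q"
  obtains w where "x = coord_vector U \<phi> q w"
proof -
  let ?C = "coord_space DIM('e)" and ?c = "coord_vector U \<phi> q"
  obtain L where L: "bij_betw L ?C (tangent_space A q)"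
    and add: "\<And>u v. u \<in> ?C \<Longrightarrow> v \<in> ?C \<Longrightarrow> L (\<lambda>i. u i + v i) = tadd (L u) (L v)"
    and scale: "\<And>u a. u \<in> ?C \<Longrightarrow> L (\<lambda>i. a * u i) = tscale a (L u)"
    using tangent_coordinates[of q] by (elim exE conjE) (rule that, blast+)
  define M where "M = inv_into ?C L"
  have M: "M y \<in> ?C" "L (M y) = y" if "y \<in> tangent_space A q" for y
    using bij_betw_inv_into_right[OF L that] bij_betwE[OF bij_betw_inv_into[OF L]] that
    by (auto simp: M_def)
  have M_L: "M (L u) = u" if "u \<in> ?C" for u
    using bij_betw_inv_into_left[OF L that] by (simp add: M_def)
  have M_add: "M (tadd y z) = (\<lambda>i. M y i + M z i)"
    if "y \<in> tangent_space A q" "z \<in> tangent_space A q" for y z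
  proof -
    have "(\<lambda>i. M y i + M z i) \<in> ?C" using M(1)[OF that(1)] M(1)[OF that(2)] by (simp add: coord_space_def)
    from M_L[OF this] show ?thesis by (simp add: add M that)
  qed
  have M_scale: "M (tscale a y) = (\<lambda>i. a * M y i)" if "y \<in> tangent_space A q" for a y
  proof -
    have "(\<lambda>i. a * M y i) \<in> ?C" using M(1)[OF that] by (simp add: coord_space_def)
    from M_L[OF this] show ?thesis by (simp add: scale M that)
  qed
  \<comment> \<open>Numbering the basis from \<open>1\<close>, as \<open>coord_space\<close> does,
    turns coordinate tuples into vectors of the model space.\<close>
  obtain h where h: "bij_betw h {1..DIM('e)} (Basis :: 'e set)"
    using ex_bij_betw_nat_finite_1[OF finite_Basis] by blast
  define G where "G y = (\<Sum>i\<in>{1..DIM('e)}. M y i *\<^sub>R h i)" for y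
  have G_inner: "G y \<bullet> h i = M y i" if "i \<in> {1..DIM('e)}" for y i
  proof -
    have "G y \<bullet> h i = (\<Sum>j\<in>{1..DIM('e)}. (if j = i then M y j else 0))"
      unfolding G_def inner_sum_left inner_scaleR_left
    proof (rule sum.cong[OF refl])
      fix j assume j: "j \<in> {1..DIM('e)}"
      have "h i \<in> Basis" "h j \<in> Basis" "h j = h i \<longleftrightarrow> j = i"
        using bij_betw_apply[OF h that] bij_betw_apply[OF h j] inj_on_eq_iff[OF bij_betw_imp_inj_on[OF h] j that]
        by blast+
      then show "M y j * (h j \<bullet> h i) = (if j = i then M y j else 0)"
        by (simp add: inner_Basis)
    qed
    then show ?thesis using that by (simp only: sum.delta finite_atLeastAtMost if_True)
  qed
  have G_inj: "y = z" if "y \<in> tangent_space A q" "z \<in> tangent_space A q" "G y = G z" for y z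
  proof -
    have "M y i = M z i" for i
    proof (cases "i \<in> {1..DIM('e)}")
      case True
      then show ?thesis using G_inner[of i y] G_inner[of i z] that(3) by simp
    next
      case False
      then show ?thesis using M(1)[OF that(1)] M(1)[OF that(2)] by (auto simp: coord_space_def)
    qed
    then have "M y = M z" by (rule ext)
    with M(2)[OF that(1)] M(2)[OF that(2)] show ?thesis by (metis (no_types))
  qed
  have T: "?c w \<in> tangent_space A q" for w
    by (rule coord_vector_in_tangent_space[OF chart_in_atlas q(1)])
  have "linear (\<lambda>w. G (?c w))"
  proof
    note lin = coord_vector_linear[OF chart_in_atlas q(1)]
    show "G (?c (w + v)) = G (?c w) + G (?c v)" for w v
    proof -
      have "?c (w + v) = tadd (?c w) (?c v)"
        by (rule ext) (simp add: tadd_def linear_add[OF lin])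
      then show ?thesis by (simp add: G_def M_add[OF T T] scaleR_add_left sum.distrib)
    qed
    show "G (?c (a *\<^sub>R w)) = a *\<^sub>R G (?c w)" for a w
    proof -
      have "?c (a *\<^sub>R w) = tscale a (?c w)"
        by (rule ext) (simp add: tscale_def linear_scale[OF lin])
      then show ?thesis by (simp add: G_def M_scale[OF T] scaleR_sum_right)
    qed
  qed
  moreover have "inj (\<lambda>w. G (?c w))"
    using G_inj[OF T T] coord_vector_inj[OF q] by (blast intro: injI)
  ultimately have "surj (\<lambda>w. G (?c w))"
    by (rule linear_injective_imp_surjective) simp
  then obtain w where "G x = G (?c w)" by (metis surjD)
  then show ?thesis using that G_inj[OF x T] by blast
qed

text \<open>In the chart both sides have the coefficients \<open>bump^3 X^b\<close>: two factors
  \<open>bump\<close> sit in \<open>component\<close> and one in \<open>coord_field\<close>. Off the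
  chart and at zeros of \<open>bump\<close> both sides vanish.\<close>

lemma component_expansion:
  assumes "X \<in> vector_fields A"
  shows "vscale (\<lambda>q. (bump q)^3) X = (\<lambda>q f. \<Sum>b\<in>Basis. vscale (component X b) (coord_field b) q f)"
proof (intro ext)
  fix q f
  show "vscale (\<lambda>q. (bump q)^3) X q f = (\<Sum>b\<in>Basis. vscale (component X b) (coord_field b) q f)"
  proof (cases "q \<in> U \<and> bump q \<noteq> 0")
    case True
    then have q: "q \<in> U" "bump q \<noteq> 0" by auto
    obtain w where w: "X q = coord_vector U \<phi> q w"
      using coord_vector_surj[OF q vector_fieldsD(1)[OF assms]] .
    have "(\<Sum>b\<in>Basis. vscale (component X b) (coord_field b) q f) =
        (bump q)^3 * (\<Sum>b\<in>Basis. (w \<bullet> b) * coord_vector U \<phi> q b f)"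
      unfolding sum_distrib_left
    proof (rule sum.cong[OF refl])
      fix b :: 'e
      have "coord_field b q f = bump q * coord_vector U \<phi> q b f"
        using q(1) by (simp add: coord_field_def bump_def)
      then show "vscale (component X b) (coord_field b) q f =
          (bump q)^3 * ((w \<bullet> b) * coord_vector U \<phi> q b f)"
        by (simp add: vscale_def tscale_def component_coord_vector[where X = X, OF q(1) w]
            power2_eq_square power3_eq_cube)
    qed
    also have "(\<Sum>b\<in>Basis. (w \<bullet> b) * coord_vector U \<phi> q b f) =
        coord_vector U \<phi> q (\<Sum>b\<in>Basis. (w \<bullet> b) *\<^sub>R b) f"
      using coord_vector_linear[OF chart_in_atlas q(1), of f] by (simp add: linear_sum[where f = "\<lambda>w. coord_vector U \<phi> q w f"]
          linear_scale[where f = "\<lambda>w. coord_vector U \<phi> q w f"])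
    finally show ?thesis by (simp add: vscale_def tscale_def w euclidean_representation)
  next
    case False
    then have "bump q = 0" "coord_field b q f = 0" for b
      by (auto simp: bump_def coord_field_def)
    then show ?thesis by (simp add: vscale_def tscale_def)
  qed
qed

text \<open>Apply \<open>T\<close> to \<open>component_expansion\<close>. The left side becomes
  \<open>(bump p)^3 * T X\<close>; on the right each summand acquires the factor
  \<open>component X b p\<close>, which is zero because \<open>X p\<close> is.\<close>

lemma tensorial_vanish:
  fixes T :: "'a vfield \<Rightarrow> real"
  assumes add: "\<And>X Y. X \<in> vector_fields A \<Longrightarrow> Y \<in> vector_fields A \<Longrightarrow> T (vadd X Y) = T X + T Y"
    and scale: "\<And>f X. f \<in> smooth_functions A \<Longrightarrow> X \<in> vector_fields A \<Longrightarrow> T (vscale f X) = f p * T X"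
    and X: "X \<in> vector_fields A" "X p = (\<lambda>f. 0)" and "bump p \<noteq> 0"
  shows "T X = 0"
proof -
  let ?V = "\<lambda>b. vscale (component X b) (coord_field b)"
  have V: "?V b \<in> vector_fields A" for b
    by (simp add: vector_fields_vscale component_smooth X coord_field_in_vector_fields)
  \<comment> \<open>The zero field is \<open>X\<close> scaled by the zero function, so
    \<open>scale\<close> determines \<open>T\<close> on it; this starts the induction over finite
    sums.\<close>
  have "vscale (\<lambda>q. 0) X = (\<lambda>p f. 0)" by (simp add: vscale_def tscale_def)
  then have zero: "T (\<lambda>p f. 0) = 0"
    using scale[OF smooth_functions_const X(1), of 0] by simp
  have "(\<lambda>q f. \<Sum>b\<in>B. ?V b q f) \<in> vector_fields A \<and>
      T (\<lambda>q f. \<Sum>b\<in>B. ?V b q f) = (\<Sum>b\<in>B. T (?V b))" if "finite B" for B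
    using that
  proof (induction B)
    case empty
    then show ?case by (simp add: vector_fields_zero zero)
  next
    case (insert b B)
    then have "(\<lambda>q f. \<Sum>b\<in>insert b B. ?V b q f) = vadd (?V b) (\<lambda>q f. \<Sum>b\<in>B. ?V b q f)"
      by (simp add: vadd_def tadd_def)
    then show ?case using insert V by (simp add: vector_fields_vadd add del: sum.insert) simp
  qed
  from this[OF finite_Basis]
  have "T (vscale (\<lambda>q. (bump q)^3) X) = (\<Sum>b\<in>Basis. T (?V b))"
    by (simp add: component_expansion[OF X(1)])
  also have "\<dots> = 0"
    by (simp add: scale component_smooth X coord_field_in_vector_fields component_def)
  finally have "(bump p)^3 * T X = 0"
    by (simp add: scale X smooth_functions_mult bump_smooth power3_eq_cube)
  then show ?thesis using assms(5) by simp
qed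

end

section \<open>Pointwise dependence of tensorial maps and extension of tangent vectors\<close>

context smooth_manifold_coordinates
begin

lemma bump_chart_exists:
  obtains U \<phi> K \<beta> where "bump_chart A U \<phi> K \<beta>" "p \<in> U" "bump_chart.bump U \<phi> \<beta> p \<noteq> 0"
proof -
  have "(\<Union>(U, \<phi>)\<in>A. U) = UNIV" using atlas unfolding smooth_atlas_def by blast
  then have "p \<in> (\<Union>(U, \<phi>)\<in>A. U)" by simp
  then obtain U \<phi> where c: "(U, \<phi>) \<in> A" and p: "p \<in> U" by (elim UN_E) (simp split: prod.splits)
  from open_contains_cball[THEN iffD1, OF chart(2)[OF c]] imageI[OF p, of \<phi>]
  obtain r where r: "r > 0" "cball (\<phi> p) r \<subseteq> \<phi> ` U" by (elim ballE exE conjE) auto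
  obtain \<beta> :: "'e \<Rightarrow> real" where \<beta>: "smooth_on UNIV \<beta>" "\<beta> (\<phi> p) \<noteq> 0"
    "\<And>y. y \<notin> cball (\<phi> p) r \<Longrightarrow> \<beta> y = 0"
    using bump_function_exists[OF r(1)] by blast
  \<comment> \<open>The compact set is the closed ball itself, chosen inside the open chart
    image.\<close>
  have bc: "bump_chart A U \<phi> (cball (\<phi> p) r) \<beta>"
    by unfold_locales (use c r \<beta> in auto)
  show thesis
    by (rule that[OF bc p]) (simp add: bump_chart.bump_def[OF bc] p \<beta>)
qed

text \<open>The difference of the two fields vanishes at \<open>p\<close>, so
  \<open>tensorial_vanish\<close> applies to it.\<close>

lemma tensorial:
  fixes T :: "'a vfield \<Rightarrow> real"
  assumes add: "\<And>X Y. X \<in> vector_fields A \<Longrightarrow> Y \<in> vector_fields A \<Longrightarrow> T (vadd X Y) = T X + T Y"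
    and scale: "\<And>f X. f \<in> smooth_functions A \<Longrightarrow> X \<in> vector_fields A \<Longrightarrow> T (vscale f X) = f p * T X"
    and X: "X \<in> vector_fields A" "Y \<in> vector_fields A" "X p = Y p"
  shows "T X = T Y"
proof -
  obtain U \<phi> K \<beta> where bc: "bump_chart A U \<phi> K \<beta>" "bump_chart.bump U \<phi> \<beta> p \<noteq> 0"
    using bump_chart_exists .
  have "vadd X (vscale (\<lambda>q. -1) Y) p = (\<lambda>f. 0)"
    by (simp add: X vadd_def vscale_def tadd_def tscale_def)
  then have "T (vadd X (vscale (\<lambda>q. -1) Y)) = 0"
    by (rule bump_chart.tensorial_vanish[OF bc(1) add scale _ _ bc(2), rotated -1])
      (simp_all add: X vector_fields_vadd vector_fields_vscale smooth_functions_const)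
  then show ?thesis
    by (simp add: add scale X vector_fields_vscale smooth_functions_const)
qed

lemma field_through:
  assumes "x \<in> tangent_space A p"
  shows "field_through A p x \<in> vector_fields A" "field_through A p x p = x"
proof -
  obtain U \<phi> K \<beta> where bc: "bump_chart A U \<phi> K \<beta>" and p: "p \<in> U" "bump_chart.bump U \<phi> \<beta> p \<noteq> 0"
    using bump_chart_exists .
  interpret bump_chart A U \<phi> K \<beta> by (rule bc)
  obtain w where w: "x = coord_vector U \<phi> p w"
    using coord_vector_surj[OF p assms] .
  \<comment> \<open>The divisor is the number \<open>bump p\<close>, not the function
    \<open>bump\<close>, so the quotient stays smooth everywhere; it only has to be right at
    \<open>p\<close>.\<close>
  let ?X = "vscale (\<lambda>q. 1 / bump p) (coord_field w)"
  have "?X \<in> vector_fields A"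
    by (simp add: vector_fields_vscale smooth_functions_const coord_field_in_vector_fields)
  moreover have "?X p = x"
    using p by (simp add: vscale_def tscale_def coord_field_def w bump_def)
  ultimately have "\<exists>X. X \<in> vector_fields A \<and> X p = x" by blast
  from someI_ex[OF this] show "field_through A p x \<in> vector_fields A" "field_through A p x p = x"
    by (simp_all add: field_through_def)
qed

end

section \<open>Tensoriality of the curvature\<close>

locale levi_civita_manifold = smooth_manifold_coordinates A
  for A :: "('a::{t2_space, second_countable_topology}, 'e::euclidean_space) chart set" +
  fixes g :: "'a metric_tensor" and D :: "'a connection"
  assumes metric: "pseudo_riemannian_metric A g"
    and levi_civita: "levi_civita_connection A g D"
begin

section \<open>Rules for the metric, the connection and the bracket\<close>

abbreviation VF :: "'a vfield set" where
  "VF \<equiv> vector_fields A"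

lemma metric_simps:
  "x \<in> tangent_space A p \<Longrightarrow> y \<in> tangent_space A p \<Longrightarrow> z \<in> tangent_space A p \<Longrightarrow>
    g p (tadd x y) z = g p x z + g p y z"
  "x \<in> tangent_space A p \<Longrightarrow> y \<in> tangent_space A p \<Longrightarrow> g p (tscale a x) y = a * g p x y"
  "x \<in> tangent_space A p \<Longrightarrow> y \<in> tangent_space A p \<Longrightarrow> z \<in> tangent_space A p \<Longrightarrow>
    g p z (tadd x y) = g p z x + g p z y"
  "x \<in> tangent_space A p \<Longrightarrow> y \<in> tangent_space A p \<Longrightarrow> g p y (tscale a x) = a * g p y x"
proof -
  have m: "\<forall>p. \<forall>x\<in>tangent_space A p. \<forall>y\<in>tangent_space A p. g p x y = g p y x"
    "\<forall>p. \<forall>x\<in>tangent_space A p. \<forall>y\<in>tangent_space A p. \<forall>z\<in>tangent_space A p.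
        g p (tadd x y) z = g p x z + g p y z"
    "\<forall>p. \<forall>x\<in>tangent_space A p. \<forall>y\<in>tangent_space A p. \<forall>a. g p (tscale a x) y = a * g p x y"
    using metric unfolding pseudo_riemannian_metric_def by blast+
  show l: "g p (tadd x y) z = g p x z + g p y z"
    if "x \<in> tangent_space A p" "y \<in> tangent_space A p" "z \<in> tangent_space A p" for x y z
    using m(2) that by simp
  show s: "g p (tscale a x) y = a * g p x y"
    if "x \<in> tangent_space A p" "y \<in> tangent_space A p" for x y
    using m(3) that by simp
  have c: "g p x y = g p y x" if "x \<in> tangent_space A p" "y \<in> tangent_space A p" for x y
    using m(1) that by simp
  show "g p z (tadd x y) = g p z x + g p z y"
    if "x \<in> tangent_space A p" "y \<in> tangent_space A p" "z \<in> tangent_space A p"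
    unfolding c[OF that(3) tangent_space_tadd[OF that(1,2)]] c[OF that(3,1)] c[OF that(3,2)]
    by (rule l[OF that])
  show "g p y (tscale a x) = a * g p y x"
    if "x \<in> tangent_space A p" "y \<in> tangent_space A p"
    unfolding c[OF that(2) tangent_space_tscale[OF that(1)]] c[OF that(2,1)]
    by (rule s[OF that])
qed

text \<open>The last rule is torsion-freeness, solved for the bracket: closure and linearity of
  \<open>lie_bracket\<close> then follow from those of \<open>D\<close>.\<close>

lemma connection:
  assumes "X \<in> VF" "Y \<in> VF"
  shows "D X Y \<in> VF"
    "Z \<in> VF \<Longrightarrow> D (vadd X Y) Z = vadd (D X Z) (D Y Z)"
    "f \<in> smooth_functions A \<Longrightarrow> D (vscale f X) Y = vscale f (D X Y)"
    "Z \<in> VF \<Longrightarrow> D X (vadd Y Z) = vadd (D X Y) (D X Z)"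
    "f \<in> smooth_functions A \<Longrightarrow> D X (vscale f Y) = vadd (vscale (\<lambda>p. X p f) Y) (vscale f (D X Y))"
    "lie_bracket X Y = vadd (D X Y) (vscale (\<lambda>p. -1) (D Y X))"
proof -
  note c = levi_civita[unfolded levi_civita_connection_def affine_connection_def]
  show "D X Y \<in> VF" using c[THEN conjunct1, THEN conjunct1] assms by simp
  show "D (vadd X Y) Z = vadd (D X Z) (D Y Z)" if "Z \<in> VF"
    using c[THEN conjunct1, THEN conjunct2, THEN conjunct1] assms that by simp
  show "D (vscale f X) Y = vscale f (D X Y)" if "f \<in> smooth_functions A"
    using c[THEN conjunct1, THEN conjunct2, THEN conjunct2, THEN conjunct1] assms that by simp
  show "D X (vadd Y Z) = vadd (D X Y) (D X Z)" if "Z \<in> VF"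
    using c[THEN conjunct1, THEN conjunct2, THEN conjunct2, THEN conjunct2, THEN conjunct1] assms that by simp
  show "D X (vscale f Y) = vadd (vscale (\<lambda>p. X p f) Y) (vscale f (D X Y))" if "f \<in> smooth_functions A"
    using c[THEN conjunct1, THEN conjunct2, THEN conjunct2, THEN conjunct2, THEN conjunct2] assms that by simp
  show "lie_bracket X Y = vadd (D X Y) (vscale (\<lambda>p. -1) (D Y X))"
    using c[THEN conjunct2, THEN conjunct1] assms by (simp add: vdiff_eq[symmetric])
qed

lemmas field_closure = vector_fields_vadd vector_fields_vscale connection(1) vector_fieldsD
  smooth_functions_const smooth_functions_mult smooth_functions_add smooth_functions_uminus

lemma lie_bracket_in_vector_fields: "X \<in> VF \<Longrightarrow> Y \<in> VF \<Longrightarrow> lie_bracket X Y \<in> VF"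
  by (simp add: connection(6) field_closure)

lemma curvature_in_vector_fields: "X \<in> VF \<Longrightarrow> Y \<in> VF \<Longrightarrow> Z \<in> VF \<Longrightarrow> curvature D X Y Z \<in> VF"
  by (simp add: curvature_def vdiff_eq field_closure lie_bracket_in_vector_fields)

lemma lie_bracket_vadd:
  "X \<in> VF \<Longrightarrow> X' \<in> VF \<Longrightarrow> Y \<in> VF \<Longrightarrow>
    lie_bracket (vadd X X') Y = vadd (lie_bracket X Y) (lie_bracket X' Y)"
  by (simp add: connection field_closure) (simp add: vadd_def vscale_def tadd_def tscale_def algebra_simps)

lemma lie_bracket_vscale:
  assumes "f \<in> smooth_functions A" "X \<in> VF" "Y \<in> VF"
  shows "lie_bracket (vscale f X) Y = vadd (vscale f (lie_bracket X Y)) (vscale (\<lambda>p. - Y p f) X)"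
  using assms
  by (simp add: connection field_closure) (simp add: vadd_def vscale_def tadd_def tscale_def algebra_simps)

section \<open>Linearity of the curvature over the smooth functions\<close>

lemma curvature_vadd_1:
  assumes "X \<in> VF" "X' \<in> VF" "Y \<in> VF" "Z \<in> VF"
  shows "curvature D (vadd X X') Y Z = vadd (curvature D X Y Z) (curvature D X' Y Z)"
  using assms
  by (simp add: curvature_def vdiff_eq lie_bracket_vadd connection(1-5) field_closure lie_bracket_in_vector_fields)
    (simp add: vadd_def vscale_def tadd_def tscale_def algebra_simps)

text \<open>Differentiating \<open>f\<close> in \<open>D Y (D (vscale f X) Z)\<close> produces
  \<open>(Y f) D X Z\<close>, which cancels against the term from
  \<open>[f X, Y] = f [X, Y] - (Y f) X\<close>.\<close>

lemma curvature_vscale_1: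
  assumes "f \<in> smooth_functions A" "X \<in> VF" "Y \<in> VF" "Z \<in> VF"
  shows "curvature D (vscale f X) Y Z = vscale f (curvature D X Y Z)"
  using assms
  by (simp add: curvature_def vdiff_eq lie_bracket_vscale connection(1-5) field_closure lie_bracket_in_vector_fields)
    (simp add: vadd_def vscale_def tadd_def tscale_def algebra_simps)

text \<open>Carries the rules for the first argument over to the second.\<close>

lemma curvature_antisym:
  assumes "X \<in> VF" "Y \<in> VF" "Z \<in> VF"
  shows "curvature D X Y Z = vscale (\<lambda>p. -1) (curvature D Y X Z)"
proof -
  have "lie_bracket X Y = vscale (\<lambda>p. -1) (lie_bracket Y X)"
    by (simp add: lie_bracket_def vscale_def tscale_def)
  then show ?thesis using assms
    by (simp add: curvature_def vdiff_eq connection(3) smooth_functions_const lie_bracket_in_vector_fields)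
      (simp add: vadd_def vscale_def tadd_def tscale_def algebra_simps)
qed

lemma curvature_vadd_2:
  assumes "X \<in> VF" "Y \<in> VF" "Y' \<in> VF" "Z \<in> VF"
  shows "curvature D X (vadd Y Y') Z = vadd (curvature D X Y Z) (curvature D X Y' Z)"
  unfolding curvature_antisym[OF assms(1) vector_fields_vadd[OF assms(2,3)] assms(4)]
    curvature_antisym[OF assms(1,2,4)] curvature_antisym[OF assms(1,3,4)]
    curvature_vadd_1[OF assms(2,3,1,4)]
  by (simp add: vadd_def vscale_def tadd_def tscale_def algebra_simps)

lemma curvature_vscale_2:
  assumes "f \<in> smooth_functions A" "X \<in> VF" "Y \<in> VF" "Z \<in> VF"
  shows "curvature D X (vscale f Y) Z = vscale f (curvature D X Y Z)"
  unfolding curvature_antisym[OF assms(2) vector_fields_vscale[OF assms(1,3)] assms(4)]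
    curvature_antisym[OF assms(2,3,4)] curvature_vscale_1[OF assms(1,3,2,4)]
  by (simp add: vscale_def tscale_def)

lemma curvature_vadd_3:
  assumes "X \<in> VF" "Y \<in> VF" "Z \<in> VF" "Z' \<in> VF"
  shows "curvature D X Y (vadd Z Z') = vadd (curvature D X Y Z) (curvature D X Y Z')"
  using assms
  by (simp add: curvature_def vdiff_eq connection(1-5) field_closure lie_bracket_in_vector_fields)
    (simp add: vadd_def vscale_def tadd_def tscale_def algebra_simps)

text \<open>The products of first derivatives of \<open>f\<close> with derivatives of
  \<open>Z\<close> cancel in pairs, and the second derivatives \<open>X (Y f) - Y (X f)\<close>
  cancel against \<open>[X, Y] f\<close>.\<close>

lemma curvature_vscale_3:
  assumes "f \<in> smooth_functions A" "X \<in> VF" "Y \<in> VF" "Z \<in> VF"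
  shows "curvature D X Y (vscale f Z) = vscale f (curvature D X Y Z)"
proof -
  \<comment> \<open>Here the bracket must appear as a commutator of derivations, not as a difference
    of covariant derivatives.\<close>
  have "lie_bracket X Y p f = X p (\<lambda>q. Y q f) - Y p (\<lambda>q. X q f)" for p
    by (simp add: lie_bracket_def)
  then show ?thesis using assms
    by (simp add: curvature_def vdiff_eq connection(1-5) field_closure lie_bracket_in_vector_fields)
      (simp add: vadd_def vscale_def tadd_def tscale_def algebra_simps)
qed

text \<open>Frees the tensor from the choice made by \<open>field_through\<close>: the chosen fields
  are exchanged one slot at a time, each time by \<open>tensorial\<close>.\<close>

lemma curvature_tensor_eq:
  assumes "X \<in> VF" "Y \<in> VF" "Z \<in> VF" "u \<in> tangent_space A p"
  shows "curvature_tensor A g D p (X p) (Y p) (Z p) u = g p (curvature D X Y Z p) u"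
proof -
  let ?T = "\<lambda>X Y Z. g p (curvature D X Y Z p) u"
  note T = vector_fieldsD(1)
  have R: "curvature D X Y Z p \<in> tangent_space A p" if "X \<in> VF" "Y \<in> VF" "Z \<in> VF" for X Y Z
    by (rule T[OF curvature_in_vector_fields[OF that]])
  have vadd: "g p (vadd V W p) u = g p (V p) u + g p (W p) u" if "V \<in> VF" "W \<in> VF" for V W
    by (simp add: vadd_def metric_simps T that assms(4))
  have vscale: "g p (vscale f V p) u = f p * g p (V p) u" if "V \<in> VF" for f V
    by (simp add: vscale_def metric_simps T that assms(4))
  have F: "field_through A p (V p) \<in> VF" "field_through A p (V p) p = V p" if "V \<in> VF" for V
    using field_through[OF T[OF that]] by auto
  let ?X = "field_through A p (X p)" and ?Y = "field_through A p (Y p)" and ?Z = "field_through A p (Z p)"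
  have "?T ?X ?Y ?Z = ?T X ?Y ?Z"
    by (rule tensorial[where T = "\<lambda>X. ?T X ?Y ?Z" and p = p])
      (simp_all add: F assms curvature_vadd_1 curvature_vscale_1 vadd vscale curvature_in_vector_fields)
  also have "\<dots> = ?T X Y ?Z"
    by (rule tensorial[where T = "\<lambda>Y. ?T X Y ?Z" and p = p])
      (simp_all add: F assms curvature_vadd_2 curvature_vscale_2 vadd vscale curvature_in_vector_fields)
  also have "\<dots> = ?T X Y Z"
    by (rule tensorial[where T = "\<lambda>Z. ?T X Y Z" and p = p])
      (simp_all add: F assms curvature_vadd_3 curvature_vscale_3 vadd vscale curvature_in_vector_fields)
  finally show ?thesis by (simp add: curvature_tensor_def)
qed

text \<open>The shape \<open>x + a x'\<close> packs additivity and homogeneity into one rewrite rule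
  per slot.\<close>

lemma curvature_tensor_lincomb:
  fixes a :: real
  assumes x: "x \<in> tangent_space A p" and x': "x' \<in> tangent_space A p"
    and y: "y \<in> tangent_space A p" and z: "z \<in> tangent_space A p" and u: "u \<in> tangent_space A p"
  defines "v \<equiv> tadd x (tscale a x')"
  shows "curvature_tensor A g D p v y z u = curvature_tensor A g D p x y z u + a * curvature_tensor A g D p x' y z u"
    and "curvature_tensor A g D p y v z u = curvature_tensor A g D p y x z u + a * curvature_tensor A g D p y x' z u"
    and "curvature_tensor A g D p y z v u = curvature_tensor A g D p y z x u + a * curvature_tensor A g D p y z x' u"
    and "curvature_tensor A g D p y z u v = curvature_tensor A g D p y z u x + a * curvature_tensor A g D p y z u x'"
proof -
  let ?F = "field_through A p"
  note F = field_through[OF x] field_through[OF x'] field_through[OF y] field_through[OF z]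
    field_through[OF u]
  \<comment> \<open>The field chosen through \<open>v\<close> need not be this combination of chosen
    fields, but \<open>curvature_tensor_eq\<close> accepts any extension of
    \<open>v\<close>.\<close>
  define V where "V = vadd (?F x) (vscale (\<lambda>q. a) (?F x'))"
  have V: "V \<in> VF" "V p = v"
    by (simp_all add: V_def v_def F field_closure) (simp add: vadd_def vscale_def F)
  have T: "curvature D X Y Z p \<in> tangent_space A p" if "X \<in> VF" "Y \<in> VF" "Z \<in> VF" for X Y Z
    by (rule vector_fieldsD(1)[OF curvature_in_vector_fields[OF that]])
  have E: "g p (vadd X (vscale (\<lambda>q. a) Y) p) w = g p (X p) w + a * g p (Y p) w"
    if "X \<in> VF" "Y \<in> VF" "w \<in> tangent_space A p" for X Y w
    using that by (simp add: vadd_def vscale_def metric_simps vector_fieldsD tangent_space_tscale)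
  have cl: "vscale (\<lambda>q. a) (?F x') \<in> VF"
    by (simp add: F field_closure)
  note Q = curvature_tensor_eq[where p = p]
  show "curvature_tensor A g D p v y z u = curvature_tensor A g D p x y z u + a * curvature_tensor A g D p x' y z u"
    using Q[of V "?F y" "?F z" u] Q[of "?F x" "?F y" "?F z" u] Q[of "?F x'" "?F y" "?F z" u]
    by (simp add: V F u) (simp add: V_def curvature_vadd_1 curvature_vscale_1 E F cl u
        smooth_functions_const curvature_in_vector_fields)
  show "curvature_tensor A g D p y v z u = curvature_tensor A g D p y x z u + a * curvature_tensor A g D p y x' z u"
    using Q[of "?F y" V "?F z" u] Q[of "?F y" "?F x" "?F z" u] Q[of "?F y" "?F x'" "?F z" u]
    by (simp add: V F u) (simp add: V_def curvature_vadd_2 curvature_vscale_2 E F cl u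
        smooth_functions_const curvature_in_vector_fields)
  show "curvature_tensor A g D p y z v u = curvature_tensor A g D p y z x u + a * curvature_tensor A g D p y z x' u"
    using Q[of "?F y" "?F z" V u] Q[of "?F y" "?F z" "?F x" u] Q[of "?F y" "?F z" "?F x'" u]
    by (simp add: V F u) (simp add: V_def curvature_vadd_3 curvature_vscale_3 E F cl u
        smooth_functions_const curvature_in_vector_fields)
  show "curvature_tensor A g D p y z u v = curvature_tensor A g D p y z u x + a * curvature_tensor A g D p y z u x'"
    unfolding curvature_tensor_def v_def
    by (simp add: metric_simps T F x x' tangent_space_tscale)
qed

end

section \<open>Quartic polynomials bounded by the square of a quadratic\<close>

text \<open>Absorbing the higher terms into the bound leaves
  \<open>\<bar>a0 + a1 * e\<bar> \<le> M * e^2\<close>. Letting \<open>e\<close> tend to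
  \<open>0\<close> kills \<open>a0\<close>; dividing by \<open>e\<close> first then kills
  \<open>a1\<close>.\<close>

lemma small_polynomial_low_coeffs:
  fixes a0 a1 a2 a3 a4 c :: real
  assumes "\<And>e. 0 < e \<Longrightarrow> e < 1 \<Longrightarrow> \<bar>a0 + a1 * e + a2 * e^2 + a3 * e^3 + a4 * e^4\<bar> \<le> c * e^2"
  shows "a0 = 0" "a1 = 0"
proof -
  \<comment> \<open>For \<open>e < 1\<close> the powers \<open>e^3\<close> and \<open>e^4\<close>
    are at most \<open>e^2\<close>, so one constant serves for all three higher terms.\<close>
  define M where "M = c + \<bar>a2\<bar> + \<bar>a3\<bar> + \<bar>a4\<bar>"
  have b: "\<bar>a0 + a1 * e\<bar> \<le> M * e^2" if e: "0 < e" "e < 1" for e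
  proof -
    have "e^3 \<le> e^2" "e^4 \<le> e^2" using e by (auto intro: power_decreasing)
    then have "\<bar>a2\<bar> * e^2 + \<bar>a3\<bar> * e^3 + \<bar>a4\<bar> * e^4 \<le> \<bar>a2\<bar> * e^2 + \<bar>a3\<bar> * e^2 + \<bar>a4\<bar> * e^2"
      by (intro add_mono mult_left_mono) auto
    moreover have "\<bar>a2 * e^2 + a3 * e^3 + a4 * e^4\<bar> \<le> \<bar>a2\<bar> * e^2 + \<bar>a3\<bar> * e^3 + \<bar>a4\<bar> * e^4"
    proof -
      have "\<bar>a2 * e^2\<bar> = \<bar>a2\<bar> * e^2" "\<bar>a3 * e^3\<bar> = \<bar>a3\<bar> * e^3" "\<bar>a4 * e^4\<bar> = \<bar>a4\<bar> * e^4"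
        using e by (simp_all add: abs_mult)
      then show ?thesis by linarith
    qed
    ultimately show ?thesis using assms[OF e] by (simp add: M_def algebra_simps) linarith
  qed
  have ev: "\<forall>\<^sub>F e in at_right 0. 0 < e \<and> e < (1::real)"
    unfolding eventually_at_right_field by (intro exI[of _ 1]) simp
  have "((\<lambda>e. a0 + a1 * e) \<longlongrightarrow> 0) (at_right 0)"
  proof (rule Lim_null_comparison)
    show "\<forall>\<^sub>F e in at_right 0. norm (a0 + a1 * e) \<le> M * e^2"
      using ev by eventually_elim (simp add: b)
    show "((\<lambda>e. M * e^2) \<longlongrightarrow> 0) (at_right 0)" by (auto intro!: tendsto_eq_intros)
  qed
  moreover have "((\<lambda>e. a0 + a1 * e) \<longlongrightarrow> a0) (at_right 0)" by (auto intro!: tendsto_eq_intros)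
  ultimately show a0: "a0 = 0" by (rule tendsto_unique[OF trivial_limit_at_right_real, rotated])
  have "((\<lambda>e::real. a1) \<longlongrightarrow> 0) (at_right 0)"
  proof (rule Lim_null_comparison)
    have "\<bar>a1\<bar> \<le> M * e" if e: "0 < e" "e < 1" for e
    proof -
      have "\<bar>a1\<bar> * e \<le> (M * e) * e" using b[OF e] a0 e by (simp add: abs_mult power2_eq_square)
      then show ?thesis using e by simp
    qed
    then show "\<forall>\<^sub>F e in at_right 0. norm a1 \<le> M * e"
      using ev by (auto elim: eventually_mono)
    show "((\<lambda>e. M * e) \<longlongrightarrow> 0) (at_right 0)" by (auto intro!: tendsto_eq_intros)
  qed
  then show "a1 = 0" by (simp add: tendsto_const_iff)
qed

text \<open>Both \<open>1\<close> and \<open>-1\<close> are double roots.\<close>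

lemma quartic_double_roots:
  fixes b0 b1 b2 b3 b4 c :: real
  assumes "\<And>s. \<bar>s\<bar> < 1 \<Longrightarrow> \<bar>b0 + b1 * s + b2 * s^2 + b3 * s^3 + b4 * s^4\<bar> \<le> c * (1 - s^2)^2"
  shows "b0 = b4" "b1 = 0" "b2 = - 2 * b4" "b3 = 0"
proof -
  have "c \<ge> 0" using assms[of 0] by simp
  \<comment> \<open>Near the root \<open>1 - s^2\<close> vanishes to first order: with
    \<open>s = 1 - e\<close> it equals \<open>e * (2 - e)\<close>, at most
    \<open>2 * e\<close>.\<close>
  have w: "c * (1 - (1 - e)^2)^2 \<le> 4 * c * e^2" if "0 < e" "e < 1" for e :: real
  proof -
    have "(1 - (1 - e)^2) = e * (2 - e)" by (simp add: power2_eq_square algebra_simps)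
    then have "(1 - (1 - e)^2)^2 = e^2 * (2 - e)^2" by (simp add: power_mult_distrib)
    also have "\<dots> \<le> e^2 * 2^2" using that by (intro mult_left_mono power_mono) auto
    finally show ?thesis using \<open>c \<ge> 0\<close> mult_left_mono by fastforce
  qed
  \<comment> \<open>The Taylor expansion at the root \<open>1\<close>, with
    \<open>s = 1 - e\<close>.\<close>
  have p: "\<bar>(b0 + b1 + b2 + b3 + b4) + (- b1 - 2 * b2 - 3 * b3 - 4 * b4) * e
      + (b2 + 3 * b3 + 6 * b4) * e^2 + (- b3 - 4 * b4) * e^3 + b4 * e^4\<bar> \<le> 4 * c * e^2"
    if e: "0 < e" "e < 1" for e
  proof -
    have "(b0 + b1 + b2 + b3 + b4) + (- b1 - 2 * b2 - 3 * b3 - 4 * b4) * e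
        + (b2 + 3 * b3 + 6 * b4) * e^2 + (- b3 - 4 * b4) * e^3 + b4 * e^4
      = b0 + b1 * (1 - e) + b2 * (1 - e)^2 + b3 * (1 - e)^3 + b4 * (1 - e)^4"
      by algebra
    moreover have "\<bar>1 - e\<bar> < 1" using e by simp
    note order_trans[OF assms[OF this] w[OF e]]
    ultimately show ?thesis by (simp only:)
  qed
  \<comment> \<open>The Taylor expansion at the root \<open>-1\<close>, with
    \<open>s = e - 1\<close>.\<close>
  have n: "\<bar>(b0 - b1 + b2 - b3 + b4) + (b1 - 2 * b2 + 3 * b3 - 4 * b4) * e
      + (b2 - 3 * b3 + 6 * b4) * e^2 + (b3 - 4 * b4) * e^3 + b4 * e^4\<bar> \<le> 4 * c * e^2"
    if e: "0 < e" "e < 1" for e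
  proof -
    have "(b0 - b1 + b2 - b3 + b4) + (b1 - 2 * b2 + 3 * b3 - 4 * b4) * e
        + (b2 - 3 * b3 + 6 * b4) * e^2 + (b3 - 4 * b4) * e^3 + b4 * e^4
      = b0 + b1 * (e - 1) + b2 * (e - 1)^2 + b3 * (e - 1)^3 + b4 * (e - 1)^4"
      by algebra
    moreover have "\<bar>e - 1\<bar> < 1" using e by simp
    note order_trans[OF assms[OF this] w[OF e, unfolded power2_commute[of 1 e]]]
    ultimately show ?thesis by (simp only:)
  qed
  note s = small_polynomial_low_coeffs[OF p] small_polynomial_low_coeffs[OF n]
  \<comment> \<open>Value and derivative vanish at both roots; these four linear equations leave
    only the multiples of \<open>(1 - s^2)^2\<close>.\<close>
  show "b0 = b4" "b1 = 0" "b2 = - 2 * b4" "b3 = 0" using s by linarith+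
qed

text \<open>The bound forces the quartic to be a multiple of
  \<open>(1 + 2 * \<beta> * t - t^2)^2\<close>, whose constant and leading coefficients are both
  \<open>1\<close>.\<close>

lemma quartic_bounded_extreme_coeffs:
  fixes a0 a1 a2 a3 a4 \<beta> c :: real
  assumes bound: "\<And>t. 1 + 2 * \<beta> * t - t^2 > 0 \<Longrightarrow>
    \<bar>a0 + a1 * t + a2 * t^2 + a3 * t^3 + a4 * t^4\<bar> \<le> c * (1 + 2 * \<beta> * t - t^2)^2"
  shows "a0 = a4"
proof -
  \<comment> \<open>The roots of \<open>1 + 2 * \<beta> * t - t^2\<close> are
    \<open>\<beta> + \<gamma>\<close> and \<open>\<beta> - \<gamma>\<close>; the substitution
    \<open>t = \<beta> + \<gamma> * s\<close> moves them to \<open>1\<close> and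
    \<open>-1\<close>.\<close>
  define \<gamma> where "\<gamma> = sqrt (1 + \<beta>^2)"
  have pos: "1 + \<beta>^2 > 0" by (simp add: add_pos_nonneg)
  then have \<gamma>: "\<gamma>^2 = 1 + \<beta>^2" "\<gamma> > 0" by (simp_all add: \<gamma>_def)
  have "\<bar>(a0 + a1 * \<beta> + a2 * \<beta>^2 + a3 * \<beta>^3 + a4 * \<beta>^4)
      + \<gamma> * (a1 + 2 * a2 * \<beta> + 3 * a3 * \<beta>^2 + 4 * a4 * \<beta>^3) * s
      + \<gamma>^2 * (a2 + 3 * a3 * \<beta> + 6 * a4 * \<beta>^2) * s^2
      + \<gamma>^3 * (a3 + 4 * a4 * \<beta>) * s^3 + \<gamma>^4 * a4 * s^4\<bar> \<le> c * (1 + \<beta>^2)^2 * (1 - s^2)^2"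
    if s: "\<bar>s\<bar> < 1" for s
  proof -
    let ?t = "\<beta> + \<gamma> * s"
    have q: "1 + 2 * \<beta> * ?t - ?t^2 = (1 + \<beta>^2) * (1 - s^2)"
    proof -
      have "1 + 2 * \<beta> * ?t - ?t^2 = 1 + \<beta>^2 - \<gamma>^2 * s^2" by algebra
      then show ?thesis by (simp add: \<gamma> algebra_simps)
    qed
    have "s^2 < 1" using s by (simp add: abs_square_less_1)
    then have "1 + 2 * \<beta> * ?t - ?t^2 > 0" unfolding q using pos by simp
    from bound[OF this] show ?thesis
      unfolding q power_mult_distrib[of "1 + \<beta>^2"] mult.assoc[symmetric]
      by (rule subst[rotated, where P = "\<lambda>z. \<bar>z\<bar> \<le> _"]) algebra
  qed
  note d = quartic_double_roots[OF this]
  \<comment> \<open>The coefficients are solved from the top down and come out as those of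
    \<open>a4 * (1 + 2 * \<beta> * t - t^2)^2\<close>.\<close>
  have a3: "a3 = - 4 * a4 * \<beta>" using d(4) \<gamma>(2) by simp
  have "\<gamma>^2 * (a2 + 3 * a3 * \<beta> + 6 * a4 * \<beta>^2) = \<gamma>^2 * (- 2 * \<gamma>^2 * a4)"
    using d(3) by (simp add: power2_eq_square power4_eq_xxxx)
  then have "a2 + 3 * a3 * \<beta> + 6 * a4 * \<beta>^2 = - 2 * (1 + \<beta>^2) * a4"
    using \<gamma>(1) pos by (simp only: mult_cancel_left) auto
  then have a2: "a2 = 4 * a4 * \<beta>^2 - 2 * a4"
    unfolding a3 by (simp add: algebra_simps power2_eq_square)
  have "a1 + 2 * a2 * \<beta> + 3 * a3 * \<beta>^2 + 4 * a4 * \<beta>^3 = 0" using d(2) \<gamma>(2) by simp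
  then have a1: "a1 = 4 * a4 * \<beta>"
    unfolding a2 a3 by (simp add: algebra_simps power2_eq_square power3_eq_cube)
  have "\<gamma>^4 = (\<gamma>^2)^2" by simp
  then have "\<gamma>^4 = (1 + \<beta>^2)^2" by (simp only: \<gamma>)
  then have "a0 + a1 * \<beta> + a2 * \<beta>^2 + a3 * \<beta>^3 + a4 * \<beta>^4 = (1 + \<beta>^2)^2 * a4"
    using d(1) by simp
  then show ?thesis unfolding a1 a2 a3
    by (simp add: algebra_simps power2_eq_square power3_eq_cube power4_eq_xxxx)
qed

section \<open>Holomorphic sectional curvature\<close>

context levi_civita_manifold
begin

lemma holomorphic_curvature_line:
  fixes J :: "'a endo_field"
  assumes J: "almost_complex_structure A J" and x: "x \<in> tangent_space A p" and y: "y \<in> tangent_space A p"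
  defines "H \<equiv> holomorphic_sectional_curvature A g J D p"
  obtains a1 a2 a3 where
    "\<forall>t. H (tadd x (tscale t y)) = H x + a1 * t + a2 * t^2 + a3 * t^3 + H y * t^4"
proof -
  let ?R = "curvature_tensor A g D p"
  have Jt: "J p z \<in> tangent_space A p" if "z \<in> tangent_space A p" for z
    using J that unfolding almost_complex_structure_def by blast
  have Ja: "J p (tadd x (tscale t y)) = tadd (J p x) (tscale t (J p y))" for t
    using J x y tangent_space_tscale[OF y] unfolding almost_complex_structure_def by simp
  define X Y where "X = J p x" and "Y = J p y"
  note T = x y Jt[OF x, folded X_def] Jt[OF y, folded Y_def] tangent_space_tadd tangent_space_tscale
  show thesis
  proof (rule that, rule allI)
    fix t
    \<comment> \<open>The coefficient of \<open>t^k\<close> sums over the ways to put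
      \<open>y\<close> or \<open>Y = J y\<close> into \<open>k\<close> of the four slots; only the
      two outer coefficients are named in the result.\<close>
    show "H (tadd x (tscale t y)) = H x
      + (?R y X X x + ?R x Y X x + ?R x X Y x + ?R x X X y) * t
      + (?R y Y X x + ?R y X Y x + ?R y X X y + ?R x Y Y x + ?R x Y X y + ?R x X Y y) * t^2
      + (?R x Y Y y + ?R y X Y y + ?R y Y X y + ?R y Y Y x) * t^3 + H y * t^4"
      unfolding H_def holomorphic_sectional_curvature_def Ja unfolding X_def[symmetric] Y_def[symmetric]
      by (simp add: curvature_tensor_lincomb T) (simp add: algebra_simps power2_eq_square power3_eq_cube power4_eq_xxxx)
  qed
qed

lemma holomorphic_curvature_tscale:
  fixes J :: "'a endo_field"
  assumes J: "almost_complex_structure A J" and x: "x \<in> tangent_space A p"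
  shows "holomorphic_sectional_curvature A g J D p (tscale a x) =
    a^4 * holomorphic_sectional_curvature A g J D p x"
proof -
  let ?R = "curvature_tensor A g D p"
  have Jx: "J p x \<in> tangent_space A p" "J p (tscale a x) = tscale a (J p x)"
    using J x unfolding almost_complex_structure_def by blast+
  \<comment> \<open>This brings scaling into the shape \<open>x + a x'\<close> of
    \<open>curvature_tensor_lincomb\<close>.\<close>
  have scale: "tscale a w = tadd w (tscale (a - 1) w)" for w :: "'a tvec"
    by (simp add: tadd_def tscale_def algebra_simps)
  show ?thesis
    unfolding holomorphic_sectional_curvature_def scale Jx(2)[unfolded scale]
    by (simp add: curvature_tensor_lincomb x Jx(1) tangent_space_tadd tangent_space_tscale)
      (simp add: algebra_simps power4_eq_xxxx)
qed

text \<open>Along \<open>x + t y\<close> the form is a quartic with outer coefficients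
  \<open>H x\<close> and \<open>H y\<close>, and \<open>g\<close> is a quadratic with two real
  roots; rescaling to unit vectors supplies the bound that makes the outer coefficients
  equal.\<close>

lemma bounded_holomorphic_curvature_opposite_units:
  fixes J :: "'a endo_field"
  assumes J: "almost_complex_structure A J"
    and bound: "\<And>x. x \<in> tangent_space A p \<Longrightarrow> g p x x = 1 \<Longrightarrow>
      \<bar>holomorphic_sectional_curvature A g J D p x\<bar> \<le> c"
    and x: "x \<in> tangent_space A p" "g p x x = 1" and y: "y \<in> tangent_space A p" "g p y y = - 1"
  shows "holomorphic_sectional_curvature A g J D p x = holomorphic_sectional_curvature A g J D p y"
proof -
  let ?H = "holomorphic_sectional_curvature A g J D p"
  \<comment> \<open>The vectors \<open>x\<close> and \<open>y\<close> may fail to be orthogonal,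
    whence the linear term of the quadratic.\<close>
  define \<beta> where "\<beta> = g p x y"
  have sym: "g p y x = \<beta>"
    using metric x y unfolding \<beta>_def pseudo_riemannian_metric_def by blast
  obtain a1 a2 a3 where H: "\<forall>t. ?H (tadd x (tscale t y)) = ?H x + a1 * t + a2 * t^2 + a3 * t^3 + ?H y * t^4"
    using holomorphic_curvature_line[OF J x(1) y(1)] .
  have "\<bar>?H x + a1 * t + a2 * t^2 + a3 * t^3 + ?H y * t^4\<bar> \<le> c * (1 + 2 * \<beta> * t - t^2)^2"
    if q: "1 + 2 * \<beta> * t - t^2 > 0" for t
  proof -
    let ?z = "tadd x (tscale t y)" and ?q = "1 + 2 * \<beta> * t - t^2"
    \<comment> \<open>Normalises \<open>?z\<close>, because \<open>g p ?z ?z = ?q\<close>.\<close>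
    define a where "a = 1 / sqrt ?q"
    have z: "?z \<in> tangent_space A p" by (intro tangent_space_tadd tangent_space_tscale x y)
    have gz: "g p ?z ?z = ?q"
      by (simp add: metric_simps tangent_space_tadd tangent_space_tscale x y sym \<beta>_def[symmetric]
          power2_eq_square algebra_simps)
    have a: "a^2 * ?q = 1" using q by (simp add: a_def power_divide)
    have "g p (tscale a ?z) (tscale a ?z) = 1"
      using a by (simp add: metric_simps tangent_space_tscale z gz power2_eq_square mult.assoc)
    from bound[OF tangent_space_tscale[OF z] this]
    have "\<bar>a^4 * ?H ?z\<bar> \<le> c" by (simp only: holomorphic_curvature_tscale[OF J z])
    then have "a^4 * \<bar>?H ?z\<bar> \<le> c" by (simp add: abs_mult)
    then have "a^4 * \<bar>?H ?z\<bar> * ?q^2 \<le> c * ?q^2" by (intro mult_right_mono) auto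
    moreover have "a^4 * \<bar>?H ?z\<bar> * ?q^2 = (a^2 * ?q)^2 * \<bar>?H ?z\<bar>" by algebra
    ultimately show ?thesis unfolding a H[rule_format] by simp
  qed
  then show ?thesis by (rule quartic_bounded_extreme_coeffs)
qed

end

text \<open>In \<open>pseudo_inner\<close> the minus signs come first, so the first standard vector
  has square \<open>-1\<close> and the last one \<open>1\<close>.\<close>

lemma has_signature_unit_vectors:
  assumes "has_signature A g k l" "0 < k" "0 < l"
  obtains x y where "x \<in> tangent_space A p" "g p x x = 1" "y \<in> tangent_space A p" "g p y y = - 1"
proof -
  let ?C = "coord_space (k + l)" and ?e = "\<lambda>i j. if j = i then 1 else 0 :: real"
  from assms(1)[unfolded has_signature_def, rule_format, of p]
  obtain L where L: "bij_betw L ?C (tangent_space A p)"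
    "\<forall>u\<in>?C. \<forall>v\<in>?C. g p (L u) (L v) = pseudo_inner k (k + l) u v"
    by blast
  have C: "?e 1 \<in> ?C" "?e (k + l) \<in> ?C" using assms(2,3) by (auto simp: coord_space_def)
  have m: "?e i j * ?e i j = ?e i j" for i j :: nat by simp
  show thesis
  proof
    show "L (?e (k + l)) \<in> tangent_space A p" "L (?e 1) \<in> tangent_space A p"
      using bij_betw_apply[OF L(1)] C by blast+
    show "g p (L (?e (k + l))) (L (?e (k + l))) = 1"
      using L(2) C assms(2,3) by (simp add: pseudo_inner_def m)
    show "g p (L (?e 1)) (L (?e 1)) = - 1"
      using L(2) C assms(2,3) by (simp add: pseudo_inner_def m)
  qed
qed

theorem theorem1:
  fixes A :: "('a::{t2_space, second_countable_topology}, 'e::euclidean_space) chart set"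
    and g :: "'a metric_tensor" and J :: "'a endo_field" and D :: "'a connection"
    and m s :: nat
  assumes "m > 1" and "0 < s" and "s < m"
    and "DIM('e) = 2 * m"
    and "almost_hermitian_manifold A g J"
    and "has_signature A g (2 * s) (2 * (m - s))"
    and "levi_civita_connection A g D"
    and "\<forall>p. \<exists>c. \<forall>x\<in>tangent_space A p. g p x x = 1 \<longrightarrow>
           \<bar>holomorphic_sectional_curvature A g J D p x\<bar> \<le> c"
  shows "pointwise_constant_hsc A g J D"
proof -
  have J: "almost_complex_structure A J"
    using assms(5) by (simp add: almost_hermitian_manifold_def)
  \<comment> \<open>The coordinates supplied by the signature thus have the dimension of the model
    space, as the locale demands.\<close>
  have dim: "2 * s + 2 * (m - s) = DIM('e)" using assms(3,4) by simp
  interpret levi_civita_manifold A g D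
  proof
    show "smooth_atlas A" "pseudo_riemannian_metric A g" "levi_civita_connection A g D"
      using assms(5,7) by (simp_all add: almost_hermitian_manifold_def)
    show "\<exists>L. bij_betw L (coord_space DIM('e)) (tangent_space A p) \<and>
       (\<forall>u\<in>coord_space DIM('e). \<forall>v\<in>coord_space DIM('e). L (\<lambda>i. u i + v i) = tadd (L u) (L v)) \<and>
       (\<forall>u\<in>coord_space DIM('e). \<forall>a. L (\<lambda>i. a * u i) = tscale a (L u))" for p
      using assms(6)[unfolded has_signature_def dim, rule_format, of p] by (elim exE conjE) (intro exI conjI)
  qed
  show ?thesis
    unfolding pointwise_constant_hsc_def
  proof
    fix p
    let ?H = "holomorphic_sectional_curvature A g J D p"
    obtain c where c: "\<And>x. x \<in> tangent_space A p \<Longrightarrow> g p x x = 1 \<Longrightarrow> \<bar>?H x\<bar> \<le> c"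
      using assms(8) by blast
    obtain x0 y0 where u: "x0 \<in> tangent_space A p" "g p x0 x0 = 1" "y0 \<in> tangent_space A p" "g p y0 y0 = - 1"
      using has_signature_unit_vectors[OF assms(6)] assms(2,3) by auto
    \<comment> \<open>Vectors of square \<open>1\<close> are compared with \<open>y0\<close>
      directly; those of square \<open>-1\<close> are compared with \<open>x0\<close>, and
      \<open>x0\<close> with \<open>y0\<close>.\<close>
    note eq = bounded_holomorphic_curvature_opposite_units[OF J c]
    have "?H x = ?H y0" if "x \<in> tangent_space A p" "g p x x = 1" for x
      by (rule eq[OF _ _ that u(3,4)])
    moreover have "?H y = ?H y0" if "y \<in> tangent_space A p" "g p y y = - 1" for y
      using eq[OF _ _ u(1,2) that] eq[OF _ _ u] by simp
    ultimately show "\<exists>k. \<forall>x\<in>tangent_space A p. g p x x = 1 \<or> g p x x = -1 \<longrightarrow> ?H x = k"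
      by blast
  qed
qed

end
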